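(* Let $m,n \in \mathbb{Z} \setminus \{ 0 \}$ and let $BS(m,n)=\langle a,b\mid b^{-1}a^m b=a^n\rangle$ be the corresponding Baumslag-Solitar group. Let $V$ be R. Thompson's group $V$. (1) If $|m| \ne |n|$, then $BS(m,n)$ fails to embed in $V$ (there is no injective group homomorphism $BS(m,n)\to V$). (2) If $|m| = |n|$, then there is an embedding (injective group homomorphism) of $BS(m,n)$ in $V$.
   Context: R. Thompson's group $V$ is the group of homeomorphisms of the Cantor set $\{0,1\}^{\omega}$ (infinite words over $\{0,1\}$) that are given by prefix replacement: there are two finite complete anti-chains $\{a_1,\dots,a_n\}$ and $\{b_1,\dots,b_n\}$ of the set $\{0,1\}^*$ of finite words (ordered by the prefix relation) such that the map sends $a_i z\mapsto b_i z$ for all $i$ and all $z\in\{0,1\}^{\omega}$. A finite anti-chain is complete if it is maximal with respect to inclusion among anti-chains. *)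

theory Defs
  imports
    "HOL-Analysis.Analysis"
    "HOL-Algebra.Group"
    "HOL-Library.Omega_Words_Fun"
    "HOL-Library.Sublist"
begin

section \<open>Group presentations\<close>

text \<open>A letter is a generator or a formal inverse of a generator: \<open>(x, True)\<close> stands for \<open>x\<close>
  and \<open>(x, False)\<close> for \<open>x\<inverse>\<close>. Every element of the type \<open>'x\<close> is a generator.\<close>

type_synonym 'x gword = "('x \<times> bool) list"

text \<open>A pair \<open>(u, v)\<close> in \<open>R\<close> is the defining relation \<open>u = v\<close>. Two words represent the same
  element of the presented group iff they are related by the least congruence on words that
  contains free cancellation and the defining relations.\<close>

inductive pres_eq :: "('x gword \<times> 'x gword) set \<Rightarrow> 'x gword \<Rightarrow> 'x gword \<Rightarrow> bool"
  for R where
  pres_refl: "pres_eq R u u"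
| pres_sym: "pres_eq R u v \<Longrightarrow> pres_eq R v u"
| pres_trans: "pres_eq R u v \<Longrightarrow> pres_eq R v w \<Longrightarrow> pres_eq R u w"
| pres_append: "pres_eq R u u' \<Longrightarrow> pres_eq R v v' \<Longrightarrow> pres_eq R (u @ v) (u' @ v')"
| pres_cancel: "pres_eq R [(x, e), (x, \<not> e)] []"
| pres_rel: "(u, v) \<in> R \<Longrightarrow> pres_eq R u v"

definition pres_class :: "('x gword \<times> 'x gword) set \<Rightarrow> 'x gword \<Rightarrow> 'x gword set" where
  "pres_class R u = {v. pres_eq R u v}"

definition presented_group :: "('x gword \<times> 'x gword) set \<Rightarrow> 'x gword set monoid" where
  "presented_group R =
    \<lparr>carrier = range (pres_class R),
     monoid.mult = (\<lambda>U V. \<Union>u\<in>U. \<Union>v\<in>V. pres_class R (u @ v)),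
     one = pres_class R []\<rparr>"

lemma pres_class_eq_iff: "pres_class R u = pres_class R v \<longleftrightarrow> pres_eq R u v"
proof
  assume "pres_class R u = pres_class R v"
  then have "v \<in> pres_class R u" by (simp add: pres_class_def pres_refl)
  then show "pres_eq R u v" by (simp add: pres_class_def)
next
  assume uv: "pres_eq R u v"
  have "pres_eq R u w \<longleftrightarrow> pres_eq R v w" for w
    using pres_trans[OF uv] pres_trans[OF pres_sym[OF uv]] by blast
  then show "pres_class R u = pres_class R v"
    by (simp add: pres_class_def)
qed

lemma presented_group_mult:
  "pres_class R u \<otimes>\<^bsub>presented_group R\<^esub> pres_class R v = pres_class R (u @ v)"
proof -
  have eq: "pres_class R (u' @ v') = pres_class R (u @ v)"
    if "u' \<in> pres_class R u" "v' \<in> pres_class R v" for u' v'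
  proof -
    have "pres_eq R (u @ v) (u' @ v')"
      using that by (intro pres_append) (simp_all add: pres_class_def)
    then show ?thesis by (simp add: pres_class_eq_iff pres_sym)
  qed
  have "u \<in> pres_class R u" "v \<in> pres_class R v"
    by (simp_all add: pres_class_def pres_refl)
  then have "(\<Union>u'\<in>pres_class R u. \<Union>v'\<in>pres_class R v. pres_class R (u' @ v')) =
      pres_class R (u @ v)"
    using eq by blast
  then show ?thesis by (simp add: presented_group_def)
qed

lemma group_presented_group: "group (presented_group R)"
proof (rule groupI)
  show "\<one>\<^bsub>presented_group R\<^esub> \<in> carrier (presented_group R)"
    by (simp add: presented_group_def)
next
  fix x y assume "x \<in> carrier (presented_group R)" "y \<in> carrier (presented_group R)"
  then show "x \<otimes>\<^bsub>presented_group R\<^esub> y \<in> carrier (presented_group R)"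
    using presented_group_mult[of R] by (auto simp: presented_group_def)
next
  fix x y z
  assume "x \<in> carrier (presented_group R)" "y \<in> carrier (presented_group R)"
    "z \<in> carrier (presented_group R)"
  then obtain u v w where "x = pres_class R u" "y = pres_class R v" "z = pres_class R w"
    by (auto simp: presented_group_def)
  then show "x \<otimes>\<^bsub>presented_group R\<^esub> y \<otimes>\<^bsub>presented_group R\<^esub> z =
      x \<otimes>\<^bsub>presented_group R\<^esub> (y \<otimes>\<^bsub>presented_group R\<^esub> z)"
    by (simp add: presented_group_mult)
next
  fix x assume "x \<in> carrier (presented_group R)"
  then obtain u where u: "x = pres_class R u"
    by (auto simp: presented_group_def)
  have one: "\<one>\<^bsub>presented_group R\<^esub> = pres_class R []"
    by (simp add: presented_group_def)
  show "\<one>\<^bsub>presented_group R\<^esub> \<otimes>\<^bsub>presented_group R\<^esub> x = x"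
    by (simp add: u one presented_group_mult)
  have "\<exists>v. pres_eq R (v @ u) []"
  proof (induction u)
    case Nil
    show ?case using pres_refl by (intro exI[of _ "[]"]) simp
  next
    case (Cons l u)
    obtain x e where l: "l = (x, e)" by force
    from Cons obtain v where v: "pres_eq R (v @ u) []" by blast
    have "pres_eq R ([(x, \<not> e)] @ [l]) []"
      using pres_cancel[of R x "\<not> e"] by (simp add: l)
    then have "pres_eq R (v @ ([(x, \<not> e), l] @ u)) (v @ ([] @ u))"
      by (intro pres_append pres_refl) simp
    then have "pres_eq R ((v @ [(x, \<not> e)]) @ l # u) (v @ u)" by simp
    then have "pres_eq R ((v @ [(x, \<not> e)]) @ l # u) []"
      using v by (rule pres_trans)
    then show ?case by blast
  qed
  then obtain v where "pres_class R (v @ u) = pres_class R []"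
    by (auto simp: pres_class_eq_iff)
  then have "pres_class R v \<otimes>\<^bsub>presented_group R\<^esub> x = \<one>\<^bsub>presented_group R\<^esub>"
    by (simp add: one u presented_group_mult)
  moreover have "pres_class R v \<in> carrier (presented_group R)"
    by (simp add: presented_group_def)
  ultimately show "\<exists>y\<in>carrier (presented_group R).
      y \<otimes>\<^bsub>presented_group R\<^esub> x = \<one>\<^bsub>presented_group R\<^esub>"
    by (rule bexI)
qed

fun word_val :: "('g, 'b) monoid_scheme \<Rightarrow> ('x \<Rightarrow> 'g) \<Rightarrow> 'x gword \<Rightarrow> 'g" where
  "word_val G f [] = \<one>\<^bsub>G\<^esub>"
| "word_val G f ((x, e) # u) = (if e then f x else inv\<^bsub>G\<^esub> f x) \<otimes>\<^bsub>G\<^esub> word_val G f u"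

lemma (in group) word_val_closed:
  "(\<And>x. f x \<in> carrier G) \<Longrightarrow> word_val G f u \<in> carrier G"
  by (induction u) auto

lemma (in group) word_val_append:
  "(\<And>x. f x \<in> carrier G) \<Longrightarrow> word_val G f (u @ v) = word_val G f u \<otimes> word_val G f v"
  by (induction u) (auto simp: word_val_closed m_assoc)

lemma (in group) word_val_pres_eq:
  assumes "pres_eq R u v" "\<And>x. f x \<in> carrier G"
    "\<And>u v. (u, v) \<in> R \<Longrightarrow> word_val G f u = word_val G f v"
  shows "word_val G f u = word_val G f v"
  using assms(1)
proof induction
  case (pres_append u u' v v')
  then show ?case using assms(2) by (simp add: word_val_append)
next
  case (pres_cancel x e)
  then show ?case using assms(2)[of x] by simp
next
  case (pres_rel u v)
  then show ?case by (rule assms(3))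
qed simp_all

lemma (in group) presented_group_universal:
  assumes "\<And>x. f x \<in> carrier G"
    "\<And>u v. (u, v) \<in> R \<Longrightarrow> word_val G f u = word_val G f v"
  shows "\<exists>h\<in>hom (presented_group R) G. \<forall>u. h (pres_class R u) = word_val G f u"
proof -
  define h where "h U = word_val G f (SOME u. U = pres_class R u)" for U
  have h: "h (pres_class R u) = word_val G f u" for u
  proof -
    have "pres_class R u = pres_class R (SOME v. pres_class R u = pres_class R v)"
      by (rule someI[where P = "\<lambda>v. pres_class R u = pres_class R v"]) simp
    then have "pres_eq R u (SOME v. pres_class R u = pres_class R v)"
      by (simp only: pres_class_eq_iff)
    from word_val_pres_eq[OF this assms] show ?thesis
      by (simp only: h_def)
  qed
  have "h \<in> hom (presented_group R) G"
  proof (rule homI)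
    fix x assume "x \<in> carrier (presented_group R)"
    then show "h x \<in> carrier G"
      by (auto simp: presented_group_def h word_val_closed assms(1))
  next
    fix x y assume "x \<in> carrier (presented_group R)" "y \<in> carrier (presented_group R)"
    then obtain u v where "x = pres_class R u" "y = pres_class R v"
      by (auto simp: presented_group_def)
    then show "h (x \<otimes>\<^bsub>presented_group R\<^esub> y) = h x \<otimes> h y"
      by (simp add: presented_group_mult h word_val_append assms(1))
  qed
  with h show ?thesis by (intro bexI[of _ h]) simp_all
qed

definition gen_pow :: "'x \<Rightarrow> int \<Rightarrow> 'x gword" where
  "gen_pow x k = replicate (nat \<bar>k\<bar>) (x, 0 \<le> k)"


section \<open>Baumslag-Solitar groups\<close>

datatype bs_gen = Gen_a | Gen_b

definition BS :: "int \<Rightarrow> int \<Rightarrow> bs_gen gword set monoid" where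
  "BS m n = presented_group
     {(gen_pow Gen_b (-1) @ gen_pow Gen_a m @ gen_pow Gen_b 1, gen_pow Gen_a n)}"

lemma group_BS: "group (BS m n)"
  by (simp add: BS_def group_presented_group)


section \<open>Thompson's group V\<close>

definition antichain :: "'a list set \<Rightarrow> bool" where
  "antichain A \<longleftrightarrow> (\<forall>u\<in>A. \<forall>v\<in>A. Sublist.prefix u v \<longrightarrow> u = v)"

definition complete_antichain :: "'a list set \<Rightarrow> bool" where
  "complete_antichain A \<longleftrightarrow> antichain A \<and> (\<forall>B. antichain B \<and> A \<subseteq> B \<longrightarrow> B = A)"

definition prefix_replacement :: "(bool word \<Rightarrow> bool word) \<Rightarrow> bool" where
  "prefix_replacement f \<longleftrightarrow> (\<exists>as bs. length as = length bs \<and> distinct as \<and> distinct bs \<and>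
     complete_antichain (set as) \<and> complete_antichain (set bs) \<and>
     (\<forall>i<length as. \<forall>z. f (as ! i \<frown> z) = bs ! i \<frown> z))"

text \<open>The Cantor set is the type \<open>bool word = nat \<Rightarrow> bool\<close> with its product topology.\<close>

definition thompson_V :: "(bool word \<Rightarrow> bool word) monoid" where
  "thompson_V =
    \<lparr>carrier = {f. (\<exists>g. homeomorphism UNIV UNIV f g) \<and> prefix_replacement f},
     monoid.mult = (\<circ>),
     one = id\<rparr>"

lemma prefix_conc_comparable:
  assumes "u \<frown> x = v \<frown> y" "length u \<le> length v"
  shows "Sublist.prefix u v"
proof -
  have "u ! i = v ! i" if "i < length u" for i
    using that assms(2) fun_cong[OF assms(1), of i] by simp
  then have "u = take (length u) v"
    using assms(2) by (intro nth_equalityI) auto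
  then show ?thesis by (metis take_is_prefix)
qed

lemma conc_left_cancel: "u \<frown> x = u \<frown> y \<longleftrightarrow> x = y"
proof
  assume *: "u \<frown> x = u \<frown> y"
  show "x = y"
  proof
    fix i show "x i = y i" using fun_cong[OF *, of "length u + i"] by simp
  qed
qed simp

lemma complete_antichain_iff_unique_prefix:
  fixes A :: "'a list set"
  assumes "finite A"
  shows "complete_antichain A \<longleftrightarrow> (\<forall>x. \<exists>!u. u \<in> A \<and> (\<exists>z. x = u \<frown> z))"
proof
  assume A: "complete_antichain A"
  show "\<forall>x. \<exists>!u. u \<in> A \<and> (\<exists>z. x = u \<frown> z)"
  proof (intro allI ex_ex1I)
    fix x :: "'a word"
    show "\<exists>u. u \<in> A \<and> (\<exists>z. x = u \<frown> z)"
    proof (rule ccontr)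
      assume no: "\<not> ?thesis"
      obtain N where N: "\<And>u. u \<in> A \<Longrightarrow> length u < N"
        using finite_nat_set_iff_bounded[of "length ` A"] assms by auto
      define p where "p = Omega_Words_Fun.prefix N x"
      have len: "length p = N" by (simp add: p_def)
      have x: "x = p \<frown> Omega_Words_Fun.suffix N x" by (simp add: p_def)
      have "\<not> Sublist.prefix u p" if u: "u \<in> A" for u
      proof
        assume "Sublist.prefix u p"
        then obtain w where "p = u @ w" by (auto simp: Sublist.prefix_def)
        then have "x = u \<frown> (w \<frown> Omega_Words_Fun.suffix N x)" using x by simp
        then show False using no u by blast
      qed
      moreover have "\<not> Sublist.prefix p u" if "u \<in> A" for u
        using N[OF that] len prefix_length_le by fastforce
      ultimately have "antichain (insert p A)"
        using A by (auto simp: complete_antichain_def antichain_def)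
      then have "insert p A = A" using A by (auto simp: complete_antichain_def)
      then show False using N len by blast
    qed
  next
    fix x u v assume "u \<in> A \<and> (\<exists>z. x = u \<frown> z)" "v \<in> A \<and> (\<exists>z. x = v \<frown> z)"
    then show "u = v"
      using A prefix_conc_comparable unfolding complete_antichain_def antichain_def
      by (metis nle_le)
  qed
next
  assume U: "\<forall>x. \<exists>!u. u \<in> A \<and> (\<exists>z. x = u \<frown> z)"
  have eq: "u = v" if uv: "u \<in> A" "v \<in> A" "Sublist.prefix u v" for u v
  proof -
    obtain w where "v = u @ w" using uv(3) by (auto simp: Sublist.prefix_def)
    then have "v \<frown> undefined = u \<frown> (w \<frown> undefined)" by simp
    then show ?thesis using U uv by metis
  qed
  have "B = A" if B: "antichain B" "A \<subseteq> B" for B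
  proof
    show "B \<subseteq> A"
    proof
      fix b assume b: "b \<in> B"
      obtain u z where u: "u \<in> A" "b \<frown> undefined = u \<frown> z" using U by metis
      then have "Sublist.prefix u b \<or> Sublist.prefix b u"
        by (metis nle_le prefix_conc_comparable)
      then show "b \<in> A" using B u b by (auto simp: antichain_def)
    qed
  qed (use B in blast)
  then show "complete_antichain A"
    using eq by (auto simp: complete_antichain_def antichain_def)
qed

text \<open>The same maps, with the antichains given as a finite set and its image under an injection.\<close>

lemma prefix_replacement_iff:
  "prefix_replacement f \<longleftrightarrow> (\<exists>A r. finite A \<and> inj_on r A \<and>
     complete_antichain A \<and> complete_antichain (r ` A) \<and>
     (\<forall>u\<in>A. \<forall>z. f (u \<frown> z) = r u \<frown> z))"
proof
  assume "prefix_replacement f"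
  then obtain as bs where *: "length as = length bs" "distinct as" "distinct bs"
    "complete_antichain (set as)" "complete_antichain (set bs)"
    "\<And>i z. i < length as \<Longrightarrow> f (as ! i \<frown> z) = bs ! i \<frown> z"
    unfolding prefix_replacement_def by blast
  define r where "r u = the (map_of (zip as bs) u)" for u
  have r: "r (as ! i) = bs ! i" if "i < length as" for i
    using that *(1,2) by (simp add: r_def map_of_zip_nth)
  have "map r as = bs"
    using r *(1) by (intro nth_equalityI) auto
  then have "r ` set as = set bs" "inj_on r (set as)"
    using *(2,3) by (auto simp: distinct_map)
  then show "\<exists>A r. finite A \<and> inj_on r A \<and> complete_antichain A \<and> complete_antichain (r ` A) \<and>
     (\<forall>u\<in>A. \<forall>z. f (u \<frown> z) = r u \<frown> z)"
    using *(4-6) r by (intro exI[of _ "set as"] exI[of _ r]) (auto simp: in_set_conv_nth)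
next
  assume "\<exists>A r. finite A \<and> inj_on r A \<and> complete_antichain A \<and> complete_antichain (r ` A) \<and>
     (\<forall>u\<in>A. \<forall>z. f (u \<frown> z) = r u \<frown> z)"
  then obtain A r where *: "finite A" "inj_on r A" "complete_antichain A"
    "complete_antichain (r ` A)" "\<And>u z. u \<in> A \<Longrightarrow> f (u \<frown> z) = r u \<frown> z"
    by blast
  obtain as where "set as = A" "distinct as"
    using finite_distinct_list[OF *(1)] by blast
  then show "prefix_replacement f"
    unfolding prefix_replacement_def using *
    by (intro exI[of _ as] exI[of _ "map r as"]) (auto simp: distinct_map)
qed

lemma continuous_on_prefix_map:
  fixes f :: "bool word \<Rightarrow> bool word"
  assumes "finite A" "complete_antichain A" "\<And>u z. u \<in> A \<Longrightarrow> f (u \<frown> z) = r u \<frown> z"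
  shows "continuous_on UNIV f"
proof (rule continuous_on_coordinatewise_then_product)
  fix n
  show "continuous_on UNIV (\<lambda>x. f x n)"
    unfolding continuous_on_def
  proof
    fix x :: "bool word"
    obtain u z where u: "u \<in> A" "x = u \<frown> z"
      using assms(2) complete_antichain_iff_unique_prefix[OF assms(1)] by blast
    have ev: "\<forall>\<^sub>F y in at x. \<forall>i\<in>{..< length u + Suc n}. y i = x i"
    proof (rule eventually_ball_finite)
      show "\<forall>i\<in>{..< length u + Suc n}. \<forall>\<^sub>F y in at x. y i = x i"
      proof
        fix i :: nat
        have "continuous_on UNIV (\<lambda>y::bool word. y i)"
          by simp
        then have "((\<lambda>y. y i) \<longlongrightarrow> x i) (at x)"
          by (simp add: continuous_on_def)
        then show "\<forall>\<^sub>F y in at x. y i = x i"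
          by (simp add: tendsto_discrete)
      qed
    qed simp
    have "f y n = f x n" if y: "\<forall>i\<in>{..< length u + Suc n}. y i = x i" for y
    proof -
      define z' where "z' = Omega_Words_Fun.suffix (length u) y"
      have "y = u \<frown> z'"
      proof
        fix i show "y i = (u \<frown> z') i"
          using y u(2) by (cases "i < length u") (auto simp: z'_def)
      qed
      then have "f y = r u \<frown> z'" "f x = r u \<frown> z" using u assms(3) by auto
      moreover have "z' i = z i" if "i < Suc n" for i
        using y that u(2) by (auto simp: z'_def)
      ultimately show ?thesis by (simp add: conc_def)
    qed
    then have "\<forall>\<^sub>F y in at x. f y n = f x n"
      by (rule eventually_mono[OF ev])
    then show "((\<lambda>x. f x n) \<longlongrightarrow> f x n) (at x within UNIV)"
      by (simp add: tendsto_discrete)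
  qed
qed

lemma prefix_replacement_inverse:
  assumes "prefix_replacement f"
  shows "\<exists>g. prefix_replacement g \<and> (\<forall>x. g (f x) = x) \<and> (\<forall>x. f (g x) = x)"
proof -
  obtain A r where A: "finite A" "inj_on r A" "complete_antichain A"
    "complete_antichain (r ` A)" "\<And>u z. u \<in> A \<Longrightarrow> f (u \<frown> z) = r u \<frown> z"
    using assms unfolding prefix_replacement_iff by blast
  have U: "\<exists>u z. u \<in> A \<and> x = u \<frown> z" for x
    using A(3) complete_antichain_iff_unique_prefix[OF A(1)] by blast
  have fin: "finite (r ` A)" using A(1) by simp
  have V: "\<exists>!v. v \<in> r ` A \<and> (\<exists>z. x = v \<frown> z)" for x
    using A(4) complete_antichain_iff_unique_prefix[OF fin] by blast
  have "inj f"
  proof (rule injI)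
    fix x y assume eq: "f x = f y"
    obtain u z where u: "u \<in> A" "x = u \<frown> z" using U by blast
    obtain v w where v: "v \<in> A" "y = v \<frown> w" using U by blast
    have e: "r u \<frown> z = r v \<frown> w" using eq u v A(5) by simp
    then have "r u = r v"
      using V[of "r u \<frown> z"] u(1) v(1) by (metis imageI)
    then have "u = v" using A(2) u(1) v(1) by (auto dest: inj_onD)
    then show "x = y" using e u v by (simp add: conc_left_cancel)
  qed
  moreover have "surj f"
  unfolding surj_def
  proof
    fix y
    obtain u z where "u \<in> A" "y = r u \<frown> z" using V[of y] by blast
    then have "f (u \<frown> z) = y" using A(5) by simp
    then show "\<exists>x. y = f x" by blast
  qed
  ultimately have fg: "inv_into UNIV f (f x) = x" "f (inv_into UNIV f x) = x" for x
    by (simp_all add: surj_f_inv_f)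
  have "prefix_replacement (inv_into UNIV f)"
    unfolding prefix_replacement_iff
  proof (intro exI conjI ballI allI)
    show "finite (r ` A)" by fact
    show "inj_on (inv_into A r) (r ` A)" by (simp add: inj_on_inv_into)
    show "complete_antichain (r ` A)" by fact
    show "complete_antichain (inv_into A r ` r ` A)" using A(2,3) by simp
    fix v z assume "v \<in> r ` A"
    then obtain u where u: "u \<in> A" "v = r u" by blast
    then have "v \<frown> z = f (u \<frown> z)" using A(5) by simp
    then show "inv_into UNIV f (v \<frown> z) = inv_into A r v \<frown> z"
      using fg u A(2) by simp
  qed
  with fg show ?thesis by blast
qed

lemma prefix_replacement_homeomorphism:
  assumes "prefix_replacement f"
  shows "\<exists>g. homeomorphism UNIV UNIV f g"
proof -
  obtain g where g: "prefix_replacement g" "\<And>x. g (f x) = x" "\<And>x. f (g x) = x"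
    using prefix_replacement_inverse[OF assms] by blast
  have cont: "continuous_on UNIV h" if "prefix_replacement h" for h
    using that continuous_on_prefix_map unfolding prefix_replacement_iff by metis
  have "surj f" "surj g" using g by (metis surjI)+
  then have "homeomorphism UNIV UNIV f g"
    using cont[OF assms] cont[OF g(1)] g by (auto simp: homeomorphism_def)
  then show ?thesis by blast
qed

lemma carrier_thompson_V: "carrier thompson_V = Collect prefix_replacement"
  using prefix_replacement_homeomorphism by (auto simp: thompson_V_def)

lemma prefix_replacement_comp:
  assumes "prefix_replacement f" "prefix_replacement g"
  shows "prefix_replacement (f \<circ> g)"
proof -
  obtain A r where A: "finite A" "inj_on r A" "complete_antichain A"
    "complete_antichain (r ` A)" "\<And>u z. u \<in> A \<Longrightarrow> g (u \<frown> z) = r u \<frown> z"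
    using assms(2) unfolding prefix_replacement_iff by blast
  obtain C s where C: "finite C" "inj_on s C" "complete_antichain C"
    "complete_antichain (s ` C)" "\<And>u z. u \<in> C \<Longrightarrow> f (u \<frown> z) = s u \<frown> z"
    using assms(1) unfolding prefix_replacement_iff by blast
  obtain f' g' where inv: "\<And>x. f' (f x) = x" "\<And>x. f (f' x) = x" "\<And>x. g' (g x) = x" "\<And>x. g (g' x) = x"
    using assms prefix_replacement_inverse by metis
  obtain L where L: "\<And>c. c \<in> C \<Longrightarrow> length c < L"
    using finite_nat_set_iff_bounded[of "length ` C"] C(1) by auto
  define W where "W = {w :: bool list. length w = L}"
  define P where "P = (\<lambda>(u, w). u @ w) ` (A \<times> W)"
  have "finite W" using finite_lists_length_eq[of "UNIV :: bool set" L] by (simp add: W_def)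
  then have finP: "finite P" using A(1) by (simp add: P_def)
  have UA: "\<exists>!u. u \<in> A \<and> (\<exists>z. x = u \<frown> z)" for x
    using A(3) complete_antichain_iff_unique_prefix[OF A(1)] by blast
  have UC: "\<exists>u z. u \<in> C \<and> x = u \<frown> z" for x
    using C(3) complete_antichain_iff_unique_prefix[OF C(1)] by blast
  have UP: "\<exists>!p. p \<in> P \<and> (\<exists>z. x = p \<frown> z)" for x
  proof (rule ex_ex1I)
    obtain u z where u: "u \<in> A" "x = u \<frown> z" using UA by blast
    have "x = (u @ Omega_Words_Fun.prefix L z) \<frown> Omega_Words_Fun.suffix L z"
      using u(2) by (metis conc_conc prefix_suffix)
    moreover have "u @ Omega_Words_Fun.prefix L z \<in> P"
      using u(1) by (auto simp: P_def W_def)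
    ultimately show "\<exists>p. p \<in> P \<and> (\<exists>z. x = p \<frown> z)" by blast
  next
    have ex: "\<exists>u w z. p = u @ w \<and> u \<in> A \<and> length w = L \<and> x = p \<frown> z"
      if "p \<in> P \<and> (\<exists>z. x = p \<frown> z)" for p
      using that by (auto simp: P_def W_def)
    fix p q assume p: "p \<in> P \<and> (\<exists>z. x = p \<frown> z)" and q: "q \<in> P \<and> (\<exists>z. x = q \<frown> z)"
    obtain u w z where 1: "p = u @ w" "u \<in> A" "length w = L" "x = p \<frown> z"
      using ex[OF p] by blast
    obtain v t y where 2: "q = v @ t" "v \<in> A" "length t = L" "x = q \<frown> y"
      using ex[OF q] by blast
    note * = 1 2
    have "x = u \<frown> (w \<frown> z)" "x = v \<frown> (t \<frown> y)" using * by simp_all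
    then have "u = v" using UA *(2,6) by metis
    then have len: "length p = length q" using * by simp
    then have "Sublist.prefix p q" using *(4,8) prefix_conc_comparable by (metis order_refl)
    then show "p = q" using len by (auto simp: Sublist.prefix_def)
  qed
  have "\<exists>t. \<forall>z. f (g (p \<frown> z)) = t \<frown> z" if pP: "p \<in> P" for p
  proof -
    obtain u w where p: "p = u @ w" "u \<in> A" "length w = L"
      using pP by (auto simp: P_def W_def)
    have g: "g (p \<frown> z) = (r u @ w) \<frown> z" for z
      using p A(5)[of u "w \<frown> z"] by simp
    obtain c y where c: "c \<in> C" "(r u @ w) \<frown> undefined = c \<frown> y" using UC by blast
    then have "Sublist.prefix c (r u @ w)"
      using prefix_conc_comparable[of c y "r u @ w" undefined] L[of c] p(3) by simp
    then obtain v where v: "r u @ w = c @ v" by (auto simp: Sublist.prefix_def)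
    have "f (g (p \<frown> z)) = (s c @ v) \<frown> z" for z
      using g[of z] v C(5)[OF c(1), of "v \<frown> z"] by simp
    then show ?thesis by blast
  qed
  then obtain t where t: "\<And>p z. p \<in> P \<Longrightarrow> f (g (p \<frown> z)) = t p \<frown> z" by metis
  have inj: "x = y" if "f (g x) = f (g y)" for x y using that inv by metis
  have same: "p = q \<and> z = y" if "p \<in> P" "q \<in> P" "t p \<frown> z = t q \<frown> y" for p q z y
  proof -
    have "p \<frown> z = q \<frown> y" using that t inj by metis
    moreover from this have "p = q" using UP that by metis
    ultimately show ?thesis by (simp add: conc_left_cancel)
  qed
  have "inj_on t P"
    using same by (metis inj_onI)
  moreover have "complete_antichain P"
    using UP complete_antichain_iff_unique_prefix[OF finP] by blast
  moreover have "complete_antichain (t ` P)"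
  proof -
    have "\<exists>!v. v \<in> t ` P \<and> (\<exists>z. x = v \<frown> z)" for x
    proof (rule ex_ex1I)
      obtain p z where p: "p \<in> P" "g' (f' x) = p \<frown> z" using UP by blast
      then have "x = t p \<frown> z" using t inv by metis
      then show "\<exists>v. v \<in> t ` P \<and> (\<exists>z. x = v \<frown> z)" using p(1) by blast
    qed (use same in blast)
    then show ?thesis
      using complete_antichain_iff_unique_prefix[of "t ` P"] finP by blast
  qed
  ultimately show ?thesis
    unfolding prefix_replacement_iff using finP t by (intro exI[of _ P] exI[of _ t]) simp
qed

lemma prefix_replacement_id: "prefix_replacement id"
proof -
  have "complete_antichain {[] :: bool list}"
    by (subst complete_antichain_iff_unique_prefix) auto
  then show ?thesis
    unfolding prefix_replacement_iff
    by (intro exI[of _ "{[]}"] exI[of _ id]) simp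
qed

lemma group_thompson_V: "group thompson_V"
proof (rule groupI)
  fix f assume "f \<in> carrier thompson_V"
  then obtain g where "prefix_replacement g" "\<forall>x. g (f x) = x"
    using prefix_replacement_inverse[of f] by (auto simp: carrier_thompson_V)
  then have "g \<in> carrier thompson_V" "g \<circ> f = id"
    by (auto simp: carrier_thompson_V)
  then show "\<exists>g\<in>carrier thompson_V. g \<otimes>\<^bsub>thompson_V\<^esub> f = \<one>\<^bsub>thompson_V\<^esub>"
    by (intro bexI[of _ g]) (simp_all add: thompson_V_def)
qed (simp_all add: carrier_thompson_V, simp_all add: thompson_V_def o_assoc
      prefix_replacement_comp prefix_replacement_id)

end

theory Submission
  imports Defs "HOL-Algebra.Coset" "HOL-Real_Asymp.Real_Asymp"
begin

text \<open>
  An element \<open>f\<close> of \<open>V\<close> acts on every sufficiently small cone \<open>u\<frown>_\<close> of the Cantor set by replacing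
  the prefix \<open>u\<close> by some \<open>v\<close>. The \<^emph>\<open>stretch\<close> of \<open>f\<close> is the largest possible value of
  \<open>\<bar>length v - length u\<bar>\<close>. It is finite, subadditive, and invariant under inversion, so it is a length
  function on \<open>V\<close>.

  \<^bold>\<open>Non-embedding.\<close> The heart of the argument is that an element of infinite order is undistorted:
  some power \<open>f ^^ t\<close> satisfies \<open>stretch (f ^^ (t * k)) \<ge> k\<close> for all \<open>k\<close>
  (\<open>infinite_order_stretch_growth\<close>). If the stretches of all powers of \<open>f\<close> are bounded, then each small
  cone has only finitely many images under the powers of \<open>f\<close>, and \<open>f\<close> has finite order. Otherwise, up to
  replacing \<open>f\<close> by its inverse, some cone prefix gets longer and longer along its orbit, and a pumping
  argument, as for pushdown automata, yields a prefix \<open>p\<close> that a power of \<open>f\<close> replaces by \<open>p @ q\<close> with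
  \<open>q \<noteq> []\<close>; that power has an attracting fixed point \<open>p\<frown>q\<frown>q\<frown>\<dots>\<close>, and iterating it adds \<open>length q\<close> letters
  each time. On the other hand, a relation \<open>b\<inverse> a\<^sup>m b = a\<^sup>n\<close> with \<open>\<bar>m\<bar> < \<bar>n\<bar>\<close> makes the power of \<open>a\<close> with
  exponent \<open>n ^ i * t\<close> conjugate, by the \<open>i\<close>-th power of \<open>b\<close>, to the one with exponent \<open>m ^ i * t\<close>; hence its length is at
  most a constant times \<open>(\<bar>m\<bar> ^ i + i)\<close>, which eventually is less than \<open>\<bar>n\<bar> ^ i\<close>
  (\<open>no_growth_if_conjugate_powers\<close>). So the image of \<open>a\<close> in \<open>V\<close> has finite order, whereas \<open>a\<close> itself
  has infinite order in \<open>BS(m,n)\<close>, as one sees from the affine maps \<open>t \<mapsto> t + 1\<close> and \<open>t \<mapsto> (m/n) t\<close>.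

  \<^bold>\<open>Embedding.\<close> Let \<open>n = d m\<close> with \<open>d = \<plusminus>1\<close>, and \<open>M = \<bar>m\<bar>\<close>. The power \<open>a\<^sup>M\<close> generates a normal subgroup,
  with quotient the free product of \<open>\<int>/M\<close> and \<open>\<int>\<close>. Two homomorphisms to \<open>V\<close> are combined. The first
  factors through that free product, which acts by ping-pong (\<open>ex_free_product_action\<close>). The second one is
  injective on the powers of \<open>a\<close>: it maps \<open>a\<close> to an element of infinite order which the image of \<open>b\<close>
  centralises or inverts (\<open>ex_commuting_or_inverting_pair\<close>). A normal form for \<open>BS(m,n)\<close>
  (\<open>reduced_normal_form\<close>) shows that the kernel of the first homomorphism consists of powers of \<open>a\<close>, so
  the two kernels meet trivially. Letting the two homomorphisms act on the two halves of the Cantor set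
  gives a single injective homomorphism (\<open>joint_embedding\<close>).
\<close>

section \<open>Prefix replacement on cones\<close>

definition maps_cone :: "('a word \<Rightarrow> 'a word) \<Rightarrow> 'a list \<Rightarrow> 'a list \<Rightarrow> bool" where
  "maps_cone f u v \<longleftrightarrow> (\<forall>z. f (u \<frown> z) = v \<frown> z)"

lemma maps_coneD: "maps_cone f u v \<Longrightarrow> f (u \<frown> z) = v \<frown> z"
  by (simp add: maps_cone_def)

lemma maps_cone_append: "maps_cone f u v \<Longrightarrow> maps_cone f (u @ w) (v @ w)"
  by (metis conc_conc maps_cone_def)

lemma maps_cone_comp: "maps_cone g u v \<Longrightarrow> maps_cone f v w \<Longrightarrow> maps_cone (f \<circ> g) u w"
  by (simp add: maps_cone_def)

lemma maps_cone_id: "maps_cone id u u"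
  by (simp add: maps_cone_def)

text \<open>Two distinct prefixes that always give the same word would differ by a nonempty word \<open>c\<close> with
  \<open>z = c \<frown> z\<close> for every \<open>z\<close>; a constant word avoiding the first letter of \<open>c\<close> refutes this. Consequently
  the word that replaces a given prefix is unique, which makes lengths of images meaningful.\<close>
lemma conc_determines_prefix:
  fixes v w :: "bool list"
  assumes "\<And>z. v \<frown> z = w \<frown> z"
  shows "v = w"
proof -
  have *: "a = b" if "length a \<le> length b" "\<And>z. a \<frown> z = b \<frown> z" for a b :: "bool list"
  proof -
    have "Sublist.prefix a b"
      using prefix_conc_comparable[OF that(2) that(1)] .
    then obtain c where c: "b = a @ c"
      by (auto simp: Sublist.prefix_def)
    have z: "z = c \<frown> z" for z
      using that(2)[of z] unfolding c by (metis conc_conc conc_left_cancel)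
    have "c = []"
    proof (rule ccontr)
      assume "c \<noteq> []"
      then have "(c \<frown> (\<lambda>_. \<not> c ! 0)) 0 = c ! 0" by simp
      then show False using fun_cong[OF z[of "\<lambda>_. \<not> c ! 0"], of 0] by simp
    qed
    then show ?thesis using c by simp
  qed
  show ?thesis
    using *[of v w] *[of w v] assms by (metis nle_le)
qed

lemma maps_cone_unique:
  fixes f :: "bool word \<Rightarrow> bool word"
  shows "maps_cone f u v \<Longrightarrow> maps_cone f u w \<Longrightarrow> v = w"
  by (rule conc_determines_prefix) (simp add: maps_cone_def)

text \<open>Cutting the Cantor set uniformly into the cones of a fixed depth, rather than along an
  antichain, turns membership in \<open>V\<close> into two conditions that are easy to check for explicit maps.\<close>
definition has_depth :: "('a word \<Rightarrow> 'a word) \<Rightarrow> nat \<Rightarrow> bool" where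
  "has_depth f N \<longleftrightarrow> (\<forall>w. N \<le> length w \<longrightarrow> (\<exists>v. maps_cone f w v))"

lemma has_depthI:
  assumes "\<And>w. length w = N \<Longrightarrow> \<exists>v. maps_cone f w v"
  shows "has_depth f N"
  unfolding has_depth_def
proof (intro allI impI)
  fix w :: "'a list" assume "N \<le> length w"
  then obtain v where "maps_cone f (take N w) v" using assms[of "take N w"] by auto
  from maps_cone_append[OF this, of "drop N w"] show "\<exists>v. maps_cone f w v" by auto
qed

lemma has_depthE:
  assumes "has_depth f N" "N \<le> length w"
  obtains v where "maps_cone f w v"
  using assms by (auto simp: has_depth_def)

text \<open>From left to right, the depth is any bound for the lengths of the words in the antichain. From right
  to left, all words of length \<open>N\<close> form the first antichain, and bijectivity makes their images
  a complete antichain.\<close>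
lemma prefix_replacement_iff_bij_depth:
  "prefix_replacement f \<longleftrightarrow> bij f \<and> (\<exists>N. has_depth f N)"
proof
  assume f: "prefix_replacement f"
  obtain g where "\<And>x. g (f x) = x" "\<And>x. f (g x) = x"
    using prefix_replacement_inverse[OF f] by blast
  then have "bij f" by (metis bijI')
  obtain A r where A: "finite A" "complete_antichain A" "\<And>u z. u \<in> A \<Longrightarrow> f (u \<frown> z) = r u \<frown> z"
    using f unfolding prefix_replacement_iff by blast
  obtain N where N: "\<And>u. u \<in> A \<Longrightarrow> length u < N"
    using finite_nat_set_iff_bounded[of "length ` A"] A(1) by auto
  have "has_depth f N"
  proof (rule has_depthI)
    fix w :: "bool list" assume w: "length w = N"
    obtain u z where u: "u \<in> A" "w \<frown> undefined = u \<frown> z"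
      using A(2) complete_antichain_iff_unique_prefix[OF A(1)] by metis
    then obtain c where "w = u @ c"
      using prefix_conc_comparable[of u z w undefined] N[of u] w
      by (auto simp: Sublist.prefix_def)
    moreover have "maps_cone f u (r u)" using A(3) u(1) by (simp add: maps_cone_def)
    ultimately show "\<exists>v. maps_cone f w v" using maps_cone_append by blast
  qed
  with \<open>bij f\<close> show "bij f \<and> (\<exists>N. has_depth f N)" by blast
next
  assume "bij f \<and> (\<exists>N. has_depth f N)"
  then obtain N where f: "bij f" and N: "has_depth f N" by blast
  define A where "A = {w :: bool list. length w = N}"
  have finA: "finite A" using finite_lists_length_eq[of "UNIV :: bool set" N] by (simp add: A_def)
  have "\<forall>w\<in>A. \<exists>v. maps_cone f w v"
    using N by (auto simp: has_depth_def A_def)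
  then obtain r where r: "\<And>w. w \<in> A \<Longrightarrow> maps_cone f w (r w)"
    by metis
  have fr: "f (w \<frown> z) = r w \<frown> z" if "w \<in> A" for w z
    using r[OF that] by (rule maps_coneD)
  have same: "u = v \<and> y = z" if "u \<in> A" "v \<in> A" "r u \<frown> y = r v \<frown> z" for u v y z
  proof -
    have "f (u \<frown> y) = f (v \<frown> z)" using that fr by simp
    then have "u \<frown> y = v \<frown> z" using bij_is_inj[OF f] by (simp add: inj_eq)
    then show ?thesis using that(1,2) by (simp add: A_def)
  qed
  have UA: "\<exists>u z. u \<in> A \<and> x = u \<frown> z" for x
  proof (intro exI conjI)
    show "Omega_Words_Fun.prefix N x \<in> A" by (simp add: A_def)
    show "x = Omega_Words_Fun.prefix N x \<frown> Omega_Words_Fun.suffix N x" by simp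
  qed
  show "prefix_replacement f"
    unfolding prefix_replacement_iff
  proof (intro exI conjI ballI allI)
    show "finite A" by fact
    show "inj_on r A" using same by (metis inj_onI)
    show "complete_antichain A"
      unfolding complete_antichain_iff_unique_prefix[OF finA]
    proof (intro allI ex_ex1I)
      fix x show "\<exists>u. u \<in> A \<and> (\<exists>z. x = u \<frown> z)" using UA by blast
    next
      fix x u v assume u: "u \<in> A \<and> (\<exists>z. x = u \<frown> z)" and v: "v \<in> A \<and> (\<exists>z. x = v \<frown> z)"
      then obtain y z where "u \<frown> y = v \<frown> z" by metis
      moreover have "length u = length v" using u v by (simp add: A_def)
      ultimately show "u = v" by simp
    qed
    show "complete_antichain (r ` A)"
      unfolding complete_antichain_iff_unique_prefix[OF finite_imageI[OF finA]]
    proof (intro allI ex_ex1I)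
      fix x
      obtain y where "x = f y" using bij_is_surj[OF f] by (metis surjD)
      moreover obtain u z where "u \<in> A" "y = u \<frown> z" using UA by blast
      ultimately have "r u \<in> r ` A" "x = r u \<frown> z" using fr by auto
      then show "\<exists>v. v \<in> r ` A \<and> (\<exists>z. x = v \<frown> z)" by blast
    qed (use same in blast)
  qed (use fr in blast)
qed

lemma thompson_V_iff: "f \<in> carrier thompson_V \<longleftrightarrow> bij f \<and> (\<exists>N. has_depth f N)"
  by (simp add: carrier_thompson_V prefix_replacement_iff_bij_depth)

lemma thompson_V_bij: "f \<in> carrier thompson_V \<Longrightarrow> bij f"
  by (simp add: thompson_V_iff)

lemma thompson_V_mult [simp]: "f \<otimes>\<^bsub>thompson_V\<^esub> g = f \<circ> g"
  by (simp add: thompson_V_def)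

lemma thompson_V_one [simp]: "\<one>\<^bsub>thompson_V\<^esub> = id"
  by (simp add: thompson_V_def)

interpretation V: group thompson_V
  by (rule group_thompson_V)

lemma thompson_V_inv:
  assumes "f \<in> carrier thompson_V"
  shows "inv\<^bsub>thompson_V\<^esub> f = inv_into UNIV f"
proof -
  have "f \<circ> inv\<^bsub>thompson_V\<^esub> f = id"
    using V.r_inv[OF assms] by simp
  then have "f ((inv\<^bsub>thompson_V\<^esub> f) x) = x" for x by (metis comp_apply id_apply)
  then show ?thesis
    using thompson_V_bij[OF assms] by (metis bij_inv_eq_iff ext)
qed

lemma thompson_V_pow: "f [^]\<^bsub>thompson_V\<^esub> (k::nat) = f ^^ k"
  by (induction k) (simp_all add: fun_eq_iff funpow_swap1)

lemma thompson_V_pow_closed: "f \<in> carrier thompson_V \<Longrightarrow> f ^^ j \<in> carrier thompson_V"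
  using V.nat_pow_closed[of f j] by (simp add: thompson_V_pow)

lemma maps_cone_inv:
  assumes "f \<in> carrier thompson_V"
  shows "maps_cone (inv\<^bsub>thompson_V\<^esub> f) u v \<longleftrightarrow> maps_cone f v u"
  using thompson_V_bij[OF assms]
  unfolding maps_cone_def thompson_V_inv[OF assms] by (metis bij_inv_eq_iff)

lemma thompson_V_int_pow_fixpoint:
  assumes "x \<in> carrier thompson_V" "x p = p"
  shows "(x [^]\<^bsub>thompson_V\<^esub> (j::int)) p = p"
proof -
  have nat: "(x [^]\<^bsub>thompson_V\<^esub> (k::nat)) p = p" for k
    by (induction k) (simp_all add: assms(2) del: V.nat_pow_Suc add: nat_pow_Suc)
  show ?thesis
  proof (cases j rule: int_cases2)
    case (nonneg k)
    then show ?thesis by (simp add: int_pow_int nat)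
  next
    case (nonpos k)
    have "x [^]\<^bsub>thompson_V\<^esub> k \<in> carrier thompson_V" using assms(1) by simp
    from thompson_V_inv[OF this] thompson_V_bij[OF this]
    have "(inv\<^bsub>thompson_V\<^esub> (x [^]\<^bsub>thompson_V\<^esub> k)) p = p"
      using nat[of k] by (metis bij_inv_eq_iff)
    then show ?thesis using nonpos by (simp add: V.int_pow_neg_int[OF assms(1)])
  qed
qed

section \<open>Stretch, a length function on V\<close>

definition stretch :: "(bool word \<Rightarrow> bool word) \<Rightarrow> nat" where
  "stretch f = Sup {nat \<bar>int (length v) - int (length u)\<bar> | u v. maps_cone f u v}"

text \<open>Extending both \<open>u\<close> and \<open>v\<close> by the same word leaves the difference of their lengths unchanged, so
  only the finitely many differences on the cones of depth \<open>N\<close> occur.\<close>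
lemma stretch_bdd:
  fixes f :: "bool word \<Rightarrow> bool word"
  assumes "has_depth f N"
  shows "bdd_above {nat \<bar>int (length v) - int (length u)\<bar> | u v. maps_cone f u v}"
proof -
  define W where "W = {w :: bool list. length w = N}"
  have "finite W" using finite_lists_length_eq[of "UNIV :: bool set" N] by (simp add: W_def)
  have "\<forall>w\<in>W. \<exists>v. maps_cone f w v"
    using assms by (auto simp: has_depth_def W_def)
  then obtain r where r: "\<And>w. w \<in> W \<Longrightarrow> maps_cone f w (r w)"
    by metis
  define D where "D w = nat \<bar>int (length (r w)) - int (length w)\<bar>" for w
  have "{nat \<bar>int (length v) - int (length u)\<bar> | u v. maps_cone f u v} \<subseteq> D ` W"
  proof clarify
    fix u v assume uv: "maps_cone f u v"
    define t where "t = u @ replicate N True"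
    have t: "maps_cone f t (v @ replicate N True)"
      using maps_cone_append[OF uv] by (simp add: t_def)
    have w: "take N t \<in> W" by (simp add: W_def t_def)
    have "maps_cone f t (r (take N t) @ drop N t)"
      using maps_cone_append[OF r[OF w], of "drop N t"] by simp
    then have "length (v @ replicate N True) = length (r (take N t) @ drop N t)"
      using maps_cone_unique[OF t] by simp
    moreover have "length t = length u + N" "length (take N t) = N" by (simp_all add: t_def)
    ultimately have "nat \<bar>int (length v) - int (length u)\<bar> = D (take N t)"
      by (simp add: D_def)
    then show "nat \<bar>int (length v) - int (length u)\<bar> \<in> D ` W" using w by blast
  qed
  then show ?thesis
    using \<open>finite W\<close> by (meson bdd_above_finite finite_imageI finite_subset)
qed

lemma stretch_upper:
  assumes "f \<in> carrier thompson_V" "maps_cone f u v"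
  shows "length v \<le> length u + stretch f" "length u \<le> length v + stretch f"
proof -
  obtain N where "has_depth f N" using assms(1) thompson_V_iff by blast
  then have "nat \<bar>int (length v) - int (length u)\<bar> \<le> stretch f"
    unfolding stretch_def using assms(2) by (intro cSup_upper stretch_bdd) auto
  then show "length v \<le> length u + stretch f" "length u \<le> length v + stretch f" by linarith+
qed

lemma stretch_le:
  assumes "f \<in> carrier thompson_V"
    and "\<And>u v. maps_cone f u v \<Longrightarrow> length v \<le> length u + c \<and> length u \<le> length v + c"
  shows "stretch f \<le> c"
  unfolding stretch_def
proof (rule cSup_least)
  obtain N where "has_depth f N" using assms(1) thompson_V_iff by blast
  then obtain v where "maps_cone f (replicate N True) v"
    by (metis has_depthE length_replicate order_refl)
  then show "{nat \<bar>int (length v) - int (length u)\<bar> | u v. maps_cone f u v} \<noteq> {}" by blast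
next
  fix x assume "x \<in> {nat \<bar>int (length v) - int (length u)\<bar> | u v. maps_cone f u v}"
  then obtain u v where "x = nat \<bar>int (length v) - int (length u)\<bar>" "maps_cone f u v" by blast
  then show "x \<le> c" using assms(2)[of u v] by linarith
qed

lemma stretch_id: "stretch id = 0"
proof -
  have "stretch \<one>\<^bsub>thompson_V\<^esub> \<le> 0"
    by (rule stretch_le[OF V.one_closed]) (auto dest: maps_cone_unique[OF maps_cone_id])
  then show ?thesis by simp
qed

lemma stretch_inv:
  assumes "f \<in> carrier thompson_V"
  shows "stretch (inv\<^bsub>thompson_V\<^esub> f) = stretch f"
  unfolding stretch_def maps_cone_inv[OF assms]
  by (rule arg_cong[where f = Sup]) (metis abs_minus_commute)

text \<open>A composition may act on a larger cone than its factors do: \<open>f \<circ> g\<close> can replace a prefix \<open>u\<close> even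
  though \<open>g\<close> does not act on \<open>u\<frown>_\<close> by a single replacement. After subdividing the cone, the
  composition factors.\<close>
lemma has_depth_comp_factor:
  fixes f g :: "bool word \<Rightarrow> bool word"
  assumes "has_depth f N" "has_depth g M" "maps_cone (f \<circ> g) u v"
  obtains w p where "maps_cone g (u @ w) p" "maps_cone f p (v @ w)"
proof -
  obtain p where p: "maps_cone g (u @ replicate M True) p"
    using has_depthE[OF assms(2), of "u @ replicate M True"] by auto
  obtain q where q: "maps_cone f (p @ replicate N True) q"
    using has_depthE[OF assms(1), of "p @ replicate N True"] by auto
  define w where "w = replicate M True @ replicate N True"
  have p': "maps_cone g (u @ w) (p @ replicate N True)"
    using maps_cone_append[OF p] by (simp add: w_def)
  have "q = v @ w"
    using maps_cone_comp[OF p' q] maps_cone_append[OF assms(3)] by (rule maps_cone_unique)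
  then show thesis using that[OF p'] q by simp
qed

lemma stretch_comp:
  assumes "f \<in> carrier thompson_V" "g \<in> carrier thompson_V"
  shows "stretch (f \<circ> g) \<le> stretch f + stretch g"
proof (rule stretch_le)
  show "f \<circ> g \<in> carrier thompson_V" using V.m_closed[OF assms] by simp
next
  fix u v assume uv: "maps_cone (f \<circ> g) u v"
  obtain N M where "has_depth f N" "has_depth g M" using assms thompson_V_iff by meson
  then obtain w p where "maps_cone g (u @ w) p" "maps_cone f p (v @ w)"
    using has_depth_comp_factor uv by blast
  then show "length v \<le> length u + (stretch f + stretch g) \<and>
      length u \<le> length v + (stretch f + stretch g)"
    using stretch_upper[OF assms(1)] stretch_upper[OF assms(2)] by fastforce
qed

section \<open>Linear growth of the stretch of powers\<close>

text \<open>A map of depth \<open>N\<close> looks only at the first \<open>N\<close> letters, like a pushdown automaton at the top of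
  its stack; the part \<open>s\<close> below stays untouched.\<close>
lemma maps_cone_strip:
  fixes f :: "bool word \<Rightarrow> bool word"
  assumes "has_depth f N" "N \<le> length x" "maps_cone f (x @ s) y"
  obtains x' where "y = x' @ s" "maps_cone f x x'"
proof -
  obtain x' where x': "maps_cone f x x'" using has_depthE[OF assms(1,2)] .
  then have "y = x' @ s"
    using maps_cone_append[OF x'] assms(3) maps_cone_unique by blast
  with x' that show thesis by blast
qed

text \<open>A time is a record when all later values exceed the value at that time. A sequence that
  climbs by at most \<open>D\<close> per step has many records if it ends much higher than it starts: the last time
  \<open>t\<close> at which the value is at most \<open>h s\<close> is a record, and since the next value is at most
  \<open>h s + D\<close>, the remaining climb from \<open>Suc t\<close> provides one record less by induction.\<close>
lemma record_times:
  fixes h :: "nat \<Rightarrow> nat"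
  assumes step: "\<And>i. i < j \<Longrightarrow> h (Suc i) \<le> h i + D" and "D > 0"
    and "s \<le> j" "h j \<ge> h s + k * D"
  shows "\<exists>S \<subseteq> {s..j}. card S = Suc k \<and> (\<forall>t\<in>S. \<forall>i. t < i \<and> i \<le> j \<longrightarrow> h t < h i)"
  using assms(3,4)
proof (induction k arbitrary: s)
  case 0
  then show ?case by (intro exI[of _ "{j}"]) auto
next
  case (Suc k)
  define T where "T = {t. s \<le> t \<and> t \<le> j \<and> h t \<le> h s}"
  have T: "finite T" "s \<in> T" using Suc.prems by (auto simp: T_def intro: finite_subset[of _ "{..j}"])
  define t where "t = Max T"
  have t: "s \<le> t" "t \<le> j" "h t \<le> h s"
  proof -
    have "t \<in> T" unfolding t_def using T by (intro Max_in) auto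
    then show "s \<le> t" "t \<le> j" "h t \<le> h s" by (simp_all add: T_def)
  qed
  have later: "h s < h i" if "t < i" "i \<le> j" for i
  proof (rule ccontr)
    assume "\<not> h s < h i"
    then have "i \<in> T" using that t by (simp add: T_def)
    then show False using Max_ge[OF T(1)] that(1) unfolding t_def by fastforce
  qed
  have "h s < h j" using Suc.prems \<open>D > 0\<close> by simp
  then have "t \<noteq> j" using t(3) by auto
  then have "t < j" using t(2) by simp
  then have "h (Suc t) + k * D \<le> h j" using step[of t] t(3) Suc.prems by simp
  then obtain S where S: "S \<subseteq> {Suc t..j}" "card S = Suc k"
      "\<forall>t\<in>S. \<forall>i. t < i \<and> i \<le> j \<longrightarrow> h t < h i"
    using Suc.IH[of "Suc t"] \<open>t < j\<close> by auto
  have "finite S" using S(1) by (rule finite_subset) simp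
  moreover have "t \<notin> S" using S(1) by auto
  ultimately have "card (insert t S) = Suc (Suc k)" using S(2) by simp
  moreover have "insert t S \<subseteq> {s..j}" using S(1) t by auto
  moreover have "\<forall>t'\<in>insert t S. \<forall>i. t' < i \<and> i \<le> j \<longrightarrow> h t' < h i"
    using S(3) later t(3) by fastforce
  ultimately show ?case by blast
qed

text \<open>One application shortens a prefix by at most \<open>stretch f\<close>, so a long enough prefix can be followed
  for \<open>j\<close> steps without ever dropping below the depth \<open>N\<close>.\<close>
lemma long_cone_orbit:
  assumes f: "f \<in> carrier thompson_V" and N: "has_depth f N"
    and "length w \<ge> N + j * stretch f" "i \<le> j"
  shows "\<exists>v. maps_cone (f ^^ i) w v \<and> length v \<ge> N + (j - i) * stretch f"
  using assms(4)
proof (induction i)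
  case 0
  then show ?case using assms(3) maps_cone_id[of w] by (auto simp: id_def)
next
  case (Suc i)
  then obtain v where v: "maps_cone (f ^^ i) w v" "length v \<ge> N + (j - i) * stretch f" by auto
  then obtain v' where v': "maps_cone f v v'" using has_depthE[OF N, of v] by auto
  have "j - i = Suc (j - Suc i)" using Suc.prems by simp
  then have "length v' \<ge> N + (j - Suc i) * stretch f"
    using stretch_upper[OF f v'] v(2) by simp
  moreover have "maps_cone (f ^^ Suc i) w v'" using maps_cone_comp[OF v(1) v'] by simp
  ultimately show ?case by blast
qed

text \<open>At a record time \<open>t\<close> of the lengths along the orbit of a cone, write the current prefix as \<open>p @ s\<close>
  with \<open>length p = N\<close>. From then on the prefix stays longer than \<open>p @ s\<close>, so \<open>s\<close> is never touched and
  the evolution is determined by \<open>p\<close>. There are only finitely many words \<open>p\<close> of length \<open>N\<close>; so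
  two record times \<open>t < t'\<close> share the same \<open>p\<close>, and between them \<open>p\<close> evolves into \<open>p @ q\<close>.\<close>
lemma expanding_orbit_pumps:
  assumes f: "f \<in> carrier thompson_V"
    and unb: "\<And>C. \<exists>j u v. maps_cone (f ^^ j) u v \<and> length v \<ge> length u + C"
  shows "\<exists>t>0. \<exists>p q. q \<noteq> [] \<and> maps_cone (f ^^ t) p (p @ q)"
proof -
  obtain N where N: "has_depth f N" using f thompson_V_iff by blast
  \<comment> \<open>The successor only serves to make \<open>D\<close> positive, as \<open>record_times\<close> demands.\<close>
  define D where "D = Suc (stretch f)"
  define W where "W = {w :: bool list. length w = N}"
  have finW: "finite W" using finite_lists_length_eq[of "UNIV :: bool set" N] by (simp add: W_def)
  obtain j u v where uv: "maps_cone (f ^^ j) u v" "length v \<ge> length u + card W * D"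
    using unb by blast
  \<comment> \<open>A subcone of \<open>u\<close> deep enough for its whole orbit to consist of cones of depth at least \<open>N\<close>.\<close>
  define e where "e = replicate (N + j * stretch f) True"
  have "\<exists>x. maps_cone (f ^^ i) (u @ e) x \<and> length x \<ge> N" if "i \<le> j" for i
    using long_cone_orbit[OF f N, of j "u @ e" i] that by (fastforce simp: e_def)
  then obtain c where c: "\<And>i. i \<le> j \<Longrightarrow> maps_cone (f ^^ i) (u @ e) (c i)"
      "\<And>i. i \<le> j \<Longrightarrow> N \<le> length (c i)"
    by metis
  have step: "maps_cone f (c i) (c (Suc i))" if "i < j" for i
    unfolding maps_cone_def
  proof
    fix z show "f (c i \<frown> z) = c (Suc i) \<frown> z"
      using maps_coneD[OF c(1)[of i], of z] maps_coneD[OF c(1)[of "Suc i"], of z] that by simp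
  qed
  have "c 0 = u @ e"
    using c(1)[of 0] maps_cone_unique[OF maps_cone_id, of "u @ e" "c 0"] by (simp add: id_def)
  moreover have "c j = v @ e"
    using maps_cone_unique[OF c(1)[of j] maps_cone_append[OF uv(1)]] by simp
  ultimately have "length (c j) \<ge> length (c 0) + card W * D" using uv(2) by simp
  moreover have "length (c (Suc i)) \<le> length (c i) + D" if "i < j" for i
    using stretch_upper(1)[OF f step[OF that]] by (simp add: D_def)
  ultimately obtain S where S: "S \<subseteq> {0..j}" "card S = Suc (card W)"
      "\<And>t i. t \<in> S \<Longrightarrow> t < i \<Longrightarrow> i \<le> j \<Longrightarrow> length (c t) < length (c i)"
    using record_times[of j "\<lambda>i. length (c i)" D 0 "card W"] by (auto simp: D_def)
  have "(\<lambda>t. take N (c t)) ` S \<subseteq> W"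
    using S(1) c(2) by (auto simp: W_def)
  then have "card ((\<lambda>t. take N (c t)) ` S) < card S"
    using card_mono[OF finW, of "(\<lambda>t. take N (c t)) ` S"] S(2) by simp
  then have "\<not> inj_on (\<lambda>t. take N (c t)) S" using pigeonhole by blast
  then obtain a b where ab: "a \<in> S" "b \<in> S" "a \<noteq> b" "take N (c a) = take N (c b)"
    unfolding inj_on_def by blast
  define t t' where "t = min a b" and "t' = max a b"
  have tt: "t \<in> S" "t' \<in> S" "t < t'" "take N (c t) = take N (c t')"
    using ab by (auto simp: t_def t'_def min_def max_def)
  define p where "p = take N (c t)"
  define s where "s = drop N (c t)"
  have ps: "c t = p @ s" by (simp add: p_def s_def)
  have "t' \<le> j" using tt(2) S(1) by auto
  have lenp: "length p = N" using c(2)[of t] tt(3) \<open>t' \<le> j\<close> by (simp add: p_def)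
  have "t + i \<le> j \<Longrightarrow> \<exists>x. c (t + i) = x @ s \<and> N \<le> length x \<and> maps_cone (f ^^ i) p x" for i
  proof (induction i)
    case 0
    then show ?case using ps lenp maps_cone_id[of p] by (simp add: id_def)
  next
    case (Suc i)
    then obtain x where x: "c (t + i) = x @ s" "N \<le> length x" "maps_cone (f ^^ i) p x" by auto
    have "maps_cone f (x @ s) (c (t + Suc i))" using step[of "t + i"] Suc.prems x(1) by simp
    then obtain x' where x': "c (t + Suc i) = x' @ s" "maps_cone f x x'"
      using maps_cone_strip[OF N x(2)] by blast
    have "length (c t) < length (c (t + Suc i))" using S(3)[OF tt(1)] Suc.prems by simp
    then have "N \<le> length x'" using x'(1) ps lenp by simp
    moreover have "maps_cone (f ^^ Suc i) p x'" using maps_cone_comp[OF x(3) x'(2)] by simp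
    ultimately show ?case using x'(1) by blast
  qed
  from this[of "t' - t"] obtain x where x: "c t' = x @ s" "N \<le> length x"
      "maps_cone (f ^^ (t' - t)) p x"
    using tt(3) \<open>t' \<le> j\<close> by auto
  have "length (c t) < length (c t')" using S(3)[OF tt(1,3)] \<open>t' \<le> j\<close> .
  then have "N < length x" using x(1) ps lenp by simp
  moreover have "p = take N x" using tt(4) x by (simp add: p_def)
  ultimately have "x = p @ drop N x" "drop N x \<noteq> []" by simp_all
  then have "maps_cone (f ^^ (t' - t)) p (p @ drop N x)" using x(3) by simp
  then show ?thesis using \<open>drop N x \<noteq> []\<close> tt(3) zero_less_diff by blast
qed

text \<open>On a cone of depth \<open>N + C\<close> all powers of \<open>f\<close> act by prefix replacement, and the new prefixes have
  length at most \<open>N + 2 C\<close>. Two powers therefore agree on the cone, and \<open>f\<close> is periodic on it. The product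
  of the periods of the finitely many cones is a period of \<open>f\<close>.\<close>
lemma bounded_stretch_periodic:
  assumes f: "f \<in> carrier thompson_V" and bd: "\<And>j. stretch (f ^^ j) \<le> C"
  shows "\<exists>t>0. f ^^ t = id"
proof -
  obtain N where N: "has_depth f N" using f thompson_V_iff by blast
  have powV: "f ^^ j \<in> carrier thompson_V" for j
    using f by (rule thompson_V_pow_closed)
  define W where "W = {w :: bool list. length w = N + C}"
  have finW: "finite W" using finite_lists_length_eq[of "UNIV :: bool set" "N + C"] by (simp add: W_def)
  have "\<exists>t>0. \<forall>z. (f ^^ t) (w \<frown> z) = w \<frown> z" if w: "w \<in> W" for w
  proof -
    have "\<exists>v. maps_cone (f ^^ j) w v" for j
    proof (induction j)
      case 0
      then show ?case using maps_cone_id[of w] by (auto simp: id_def)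
    next
      case (Suc j)
      then obtain v where v: "maps_cone (f ^^ j) w v" by blast
      have "length w \<le> length v + C" using stretch_upper(2)[OF powV v] bd[of j] by simp
      then have "N \<le> length v" using w by (simp add: W_def)
      then obtain v' where "maps_cone f v v'" using has_depthE[OF N] by blast
      then have "maps_cone (f ^^ Suc j) w v'" using maps_cone_comp[OF v] by simp
      then show ?case by blast
    qed
    then obtain c where c: "\<And>j. maps_cone (f ^^ j) w (c j)" by metis
    have "length (c j) \<le> N + C + C" for j
      using stretch_upper(1)[OF powV c[of j]] bd[of j] w by (simp add: W_def)
    then have "range c \<subseteq> {v. set v \<subseteq> UNIV \<and> length v \<le> N + C + C}" by auto
    then have "finite (range c)"
      by (rule finite_subset) (rule finite_lists_length_le, simp)
    then have "\<not> inj c" by (metis finite_imageD infinite_UNIV_nat)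
    then obtain i j where ij: "i < j" "c i = c j" by (metis inj_def nat_neq_iff)
    have "(f ^^ (j - i)) (w \<frown> z) = w \<frown> z" for z
    proof -
      have "(f ^^ i) ((f ^^ (j - i)) (w \<frown> z)) = (f ^^ j) (w \<frown> z)"
        using ij(1) funpow_add[of i "j - i" f] by simp
      also have "\<dots> = (f ^^ i) (w \<frown> z)"
        using maps_coneD[OF c] ij(2) by metis
      finally show ?thesis using bij_is_inj[OF thompson_V_bij[OF powV]] by (simp add: inj_eq)
    qed
    then show ?thesis using ij(1) by (intro exI[of _ "j - i"]) simp
  qed
  then obtain t where t: "\<And>w. w \<in> W \<Longrightarrow> t w > 0" "\<And>w z. w \<in> W \<Longrightarrow> (f ^^ t w) (w \<frown> z) = w \<frown> z"
    by metis
  define T where "T = (\<Prod>w\<in>W. t w)"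
  have "(f ^^ T) x = x" for x
  proof -
    define w where "w = Omega_Words_Fun.prefix (N + C) x"
    define z where "z = Omega_Words_Fun.suffix (N + C) x"
    have x: "x = w \<frown> z" by (simp add: w_def z_def)
    have w: "w \<in> W" by (simp add: W_def w_def)
    have "t w dvd T" unfolding T_def using finW w by (rule dvd_prodI)
    then obtain k where k: "T = t w * k" by blast
    have "((f ^^ t w) ^^ k) x = x" by (induction k) (simp_all add: x t(2)[OF w])
    then show ?thesis by (simp add: k funpow_mult)
  qed
  moreover have "T > 0" unfolding T_def using t(1) by (rule prod_pos)
  ultimately show ?thesis by (intro exI[of _ T]) (simp add: fun_eq_iff)
qed

lemma maps_cone_pump:
  assumes "maps_cone f p (p @ q)"
  shows "maps_cone (f ^^ k) p (p @ concat (replicate k q))"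
proof (induction k)
  case 0
  then show ?case using maps_cone_id[of p] by (simp add: id_def)
next
  case (Suc k)
  from maps_cone_comp[OF this maps_cone_append[OF assms]] show ?case by (simp add: comp_def)
qed

lemma pumped_stretch_growth:
  assumes f: "f \<in> carrier thompson_V"
    and unb: "\<And>C. \<exists>j u v. maps_cone (f ^^ j) u v \<and> length v \<ge> length u + C"
  shows "\<exists>t>0. \<forall>k. k \<le> stretch (f ^^ (t * k))"
proof -
  obtain t p q where t: "t > 0" "q \<noteq> []" "maps_cone (f ^^ t) p (p @ q)"
    using expanding_orbit_pumps[OF assms] by blast
  have "k \<le> stretch (f ^^ (t * k))" for k
  proof -
    have "maps_cone (f ^^ (t * k)) p (p @ concat (replicate k q))"
      using maps_cone_pump[OF t(3), of k] by (simp add: funpow_mult)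
    from stretch_upper(1)[OF thompson_V_pow_closed[OF f] this]
    have "k * length q \<le> stretch (f ^^ (t * k))" by (simp add: length_concat sum_list_replicate)
    moreover have "k \<le> k * length q" using t(2) by (cases q) auto
    ultimately show ?thesis by linarith
  qed
  then show ?thesis using t(1) by blast
qed

text \<open>If the stretches of the powers are unbounded, then prefixes become arbitrarily much longer or
  arbitrarily much shorter; the latter is the former for the inverse, whose powers have the same
  stretches.\<close>
lemma infinite_order_stretch_growth:
  assumes f: "f \<in> carrier thompson_V" and inf: "\<And>t. t > 0 \<Longrightarrow> f ^^ t \<noteq> id"
  shows "\<exists>t>0. \<forall>k. k \<le> stretch (f ^^ (t * k))"
proof -
  define g where "g = inv\<^bsub>thompson_V\<^esub> f"
  have g: "g \<in> carrier thompson_V" using f by (simp add: g_def)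
  have pow_inv: "g ^^ j = inv\<^bsub>thompson_V\<^esub> (f ^^ j)" for j
    using V.nat_pow_inv[OF f, of j] by (simp add: g_def thompson_V_pow)
  consider (expand) "\<And>C. \<exists>j u v. maps_cone (f ^^ j) u v \<and> length v \<ge> length u + C"
    | (contract) "\<And>C. \<exists>j u v. maps_cone (f ^^ j) v u \<and> length v \<ge> length u + C"
    | (bounded) C where "\<And>j. stretch (f ^^ j) \<le> C"
  proof (cases "(\<forall>C. \<exists>j u v. maps_cone (f ^^ j) u v \<and> length v \<ge> length u + C) \<or>
      (\<forall>C. \<exists>j u v. maps_cone (f ^^ j) v u \<and> length v \<ge> length u + C)")
    case True
    then show ?thesis using expand contract by blast
  next
    case False
    then obtain C D where C: "\<And>j u v. maps_cone (f ^^ j) u v \<Longrightarrow> \<not> length v \<ge> length u + C"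
      and D: "\<And>j u v. maps_cone (f ^^ j) v u \<Longrightarrow> \<not> length v \<ge> length u + D" by blast
    have "stretch (f ^^ j) \<le> C + D" for j
    proof (rule stretch_le[OF thompson_V_pow_closed[OF f]])
      fix u v assume "maps_cone (f ^^ j) u v"
      from C[OF this] D[OF this]
      show "length v \<le> length u + (C + D) \<and> length u \<le> length v + (C + D)" by simp
    qed
    then show ?thesis by (rule bounded)
  qed
  then show ?thesis
  proof cases
    case expand
    then show ?thesis by (rule pumped_stretch_growth[OF f])
  next
    case contract
    have "\<exists>j u v. maps_cone (g ^^ j) u v \<and> length v \<ge> length u + C" for C
      using contract[of C] maps_cone_inv[OF thompson_V_pow_closed[OF f]] by (simp add: pow_inv)
    then have "\<exists>t>0. \<forall>k. k \<le> stretch (g ^^ (t * k))" by (rule pumped_stretch_growth[OF g])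
    then show ?thesis by (simp add: pow_inv stretch_inv thompson_V_pow_closed[OF f])
  next
    case bounded
    then show ?thesis using bounded_stretch_periodic[OF f] inf by blast
  qed
qed

section \<open>Conjugate powers in groups with a length function\<close>

lemma power_not_le_power_plus_linear:
  fixes c d q r :: nat
  assumes "0 < q" "q < r"
  shows "\<exists>i. q ^ i * d + i * c < r ^ i"
proof (rule ccontr)
  assume "\<not> ?thesis"
  then have le: "r ^ i \<le> q ^ i * d + i * c" for i by (meson not_le)
  define s where "s = real r / real q"
  have "s > 1" using assms by (simp add: s_def)
  then have "\<forall>\<^sub>F i in sequentially. real d + real i * real c < s ^ i"
    by real_asymp
  then obtain i where i: "real d + real i * real c < s ^ i"
    using eventually_happens' sequentially_bot by blast
  have "real r ^ i \<le> real q ^ i * real d + real i * real c"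
    using le[of i] by (metis of_nat_add of_nat_le_iff of_nat_mult of_nat_power)
  also have "\<dots> \<le> real q ^ i * (real d + real i * real c)"
  proof -
    have "1 \<le> real q ^ i" using assms(1) by (intro one_le_power) simp
    then have "1 * (real i * real c) \<le> real q ^ i * (real i * real c)"
      by (rule mult_right_mono) simp
    then show ?thesis by (simp add: distrib_left)
  qed
  finally have "s ^ i \<le> real d + real i * real c"
    using assms(1) by (simp add: s_def power_divide field_simps)
  with i show False by simp
qed

lemma (in group) conjugate_commute:
  assumes "b \<in> carrier G" "x \<in> carrier G" "y \<in> carrier G" "inv b \<otimes> x \<otimes> b = y"
  shows "b \<otimes> y = x \<otimes> b"
  using assms(1-3) by (simp add: assms(4)[symmetric] m_assoc[symmetric])

lemma (in group) conjugate_swap: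
  assumes "b \<in> carrier G" "x \<in> carrier G" "y \<in> carrier G" "inv b \<otimes> x \<otimes> b = y"
  shows "b \<otimes> y \<otimes> inv b = x"
  using conjugate_commute[OF assms] assms(1-3) by (simp add: m_assoc)

lemma (in group) conjugation_hom:
  assumes "b \<in> carrier G"
  shows "(\<lambda>x. inv b \<otimes> x \<otimes> b) \<in> hom G G"
proof (rule homI)
  fix x y assume xy: "x \<in> carrier G" "y \<in> carrier G"
  have "b \<otimes> (inv b \<otimes> (y \<otimes> b)) = y \<otimes> b"
    using assms xy by (simp add: m_assoc[symmetric])
  then show "inv b \<otimes> (x \<otimes> y) \<otimes> b = inv b \<otimes> x \<otimes> b \<otimes> (inv b \<otimes> y \<otimes> b)"
    using assms xy by (simp add: m_assoc)
qed (use assms in simp)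

lemma (in group) conjugation_int_pow:
  assumes "a \<in> carrier G" "b \<in> carrier G"
  shows "inv b \<otimes> a [^] (k::int) \<otimes> b = (inv b \<otimes> a \<otimes> b) [^] k"
  using hom_int_pow[OF conjugation_hom[OF assms(2)] assms(1) is_group is_group] .

text \<open>The relation is used \<open>i\<close> times: conjugating by \<open>b\<close> turns a factor \<open>m\<close> of the exponent into a
  factor \<open>n\<close> at the cost of \<open>2 * len b\<close>. So the power of \<open>a\<close> with exponent \<open>n ^ i * t\<close> has length
  at most \<open>\<bar>m\<bar> ^ i * t * len a + 2 * i * len b\<close>, which cannot stay above \<open>\<bar>n\<bar> ^ i\<close>.\<close>
lemma (in group) no_growth_if_conjugate_powers:
  fixes len :: "'a \<Rightarrow> nat" and m n :: int and t :: nat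
  assumes len_mult: "\<And>x y. x \<in> carrier G \<Longrightarrow> y \<in> carrier G \<Longrightarrow> len (x \<otimes> y) \<le> len x + len y"
    and len_inv: "\<And>x. x \<in> carrier G \<Longrightarrow> len (inv x) = len x"
    and len_one: "len \<one> = 0"
    and a: "a \<in> carrier G" and b: "b \<in> carrier G"
    and rel: "inv b \<otimes> a [^] m \<otimes> b = a [^] n"
    and "m \<noteq> 0" "\<bar>m\<bar> < \<bar>n\<bar>"
  shows "\<exists>k. len (a [^] (t * k)) < k"
proof (rule ccontr)
  assume "\<not> ?thesis"
  then have growth: "k \<le> len (a [^] (t * k))" for k by (meson not_le)
  have conj: "len (a [^] (n ^ i * k)) \<le> len (a [^] (m ^ i * k)) + i * (2 * len b)" for i k
  proof (induction i arbitrary: k)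
    case (Suc i)
    define y where "y = a [^] (m ^ Suc i * k)"
    have y: "y \<in> carrier G" using a by (simp add: y_def)
    have "y = (a [^] m) [^] (m ^ i * k)" using a by (simp add: y_def int_pow_pow mult.assoc)
    then have "inv b \<otimes> y \<otimes> b = (a [^] n) [^] (m ^ i * k)"
      using conjugation_int_pow[of "a [^] m" b "m ^ i * k"] a b rel by simp
    then have "a [^] (m ^ i * (n * k)) = inv b \<otimes> y \<otimes> b"
      using a by (simp add: int_pow_pow mult.left_commute)
    also have "len \<dots> \<le> len y + 2 * len b"
      using len_mult[of "inv b \<otimes> y" b] len_mult[of "inv b" y] len_inv[OF b] b y by simp
    finally have "len (a [^] (m ^ i * (n * k))) \<le> len y + 2 * len b" .
    then show ?case using Suc.IH[of "n * k"] by (simp add: y_def mult_ac)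
  qed simp
  have len_nat_pow: "len (a [^] k) \<le> k * len a" for k :: nat
  proof (induction k)
    case (Suc k)
    then show ?case using len_mult[of "a [^] k" a] a by simp
  qed (simp add: len_one)
  have len_abs: "len (a [^] k) = len (a [^] nat \<bar>k\<bar>)" for k :: int
  proof (cases "k \<ge> 0")
    case True
    then show ?thesis using int_pow_int[of G a "nat k"] by simp
  next
    case False
    then have "a [^] k = inv (a [^] nat \<bar>k\<bar>)"
      using int_pow_neg_int[OF a, of "nat \<bar>k\<bar>"] by simp
    then show ?thesis using len_inv a by simp
  qed
  have "nat \<bar>n\<bar> ^ i \<le> nat \<bar>m\<bar> ^ i * (t * len a) + i * (2 * len b)" for i
  proof -
    have nat_pow: "nat \<bar>k ^ i * int t\<bar> = nat \<bar>k\<bar> ^ i * t" for k :: int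
      by (simp add: abs_mult power_abs nat_mult_distrib nat_power_eq)
    have "nat \<bar>n\<bar> ^ i \<le> len (a [^] (n ^ i * int t))"
      using growth[of "nat \<bar>n\<bar> ^ i"] by (simp only: len_abs nat_pow mult.commute[of t])
    also have "\<dots> \<le> len (a [^] (m ^ i * int t)) + i * (2 * len b)" by (rule conj)
    also have "len (a [^] (m ^ i * int t)) \<le> nat \<bar>m\<bar> ^ i * t * len a"
      using len_nat_pow[of "nat \<bar>m\<bar> ^ i * t"] by (simp only: len_abs nat_pow)
    finally show ?thesis by (simp add: mult.assoc)
  qed
  moreover have "0 < nat \<bar>m\<bar>" "nat \<bar>m\<bar> < nat \<bar>n\<bar>" using assms(7,8) by auto
  ultimately show False
    using power_not_le_power_plus_linear[of "nat \<bar>m\<bar>" "nat \<bar>n\<bar>" "t * len a" "2 * len b"]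
    by (meson not_le)
qed

text \<open>The case \<open>\<bar>m\<bar> > \<bar>n\<bar>\<close> reduces to \<open>\<bar>m\<bar> < \<bar>n\<bar>\<close> by exchanging \<open>b\<close> with its inverse.\<close>
lemma conjugate_powers_in_thompson_V:
  fixes m n :: int
  assumes a: "a \<in> carrier thompson_V" and b: "b \<in> carrier thompson_V"
    and rel: "inv\<^bsub>thompson_V\<^esub> b \<otimes>\<^bsub>thompson_V\<^esub> a [^]\<^bsub>thompson_V\<^esub> m \<otimes>\<^bsub>thompson_V\<^esub> b = a [^]\<^bsub>thompson_V\<^esub> n"
    and "m \<noteq> 0" "n \<noteq> 0" "\<bar>m\<bar> \<noteq> \<bar>n\<bar>"
  shows "\<exists>t>0. a [^]\<^bsub>thompson_V\<^esub> (t::nat) = \<one>\<^bsub>thompson_V\<^esub>"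
proof (rule ccontr)
  assume "\<not> ?thesis"
  then have "a [^]\<^bsub>thompson_V\<^esub> t \<noteq> \<one>\<^bsub>thompson_V\<^esub>" if "t > 0" for t :: nat
    using that by blast
  then have "a ^^ t \<noteq> id" if "t > 0" for t
    using that by (simp add: thompson_V_pow)
  from infinite_order_stretch_growth[OF a this]
  obtain t where t: "\<And>k. k \<le> stretch (a [^]\<^bsub>thompson_V\<^esub> (t * k))"
    by (auto simp: thompson_V_pow)
  have len: "stretch (f \<otimes>\<^bsub>thompson_V\<^esub> g) \<le> stretch f + stretch g"
    if "f \<in> carrier thompson_V" "g \<in> carrier thompson_V" for f g
    using stretch_comp[OF that] by simp
  have one: "stretch \<one>\<^bsub>thompson_V\<^esub> = 0" by (simp add: stretch_id)
  have small: "\<exists>k. stretch (a [^]\<^bsub>thompson_V\<^esub> (t * k)) < k"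
  proof (cases "\<bar>m\<bar> < \<bar>n\<bar>")
    case True
    show ?thesis
      by (rule V.no_growth_if_conjugate_powers[OF len stretch_inv one a b rel assms(4) True])
  next
    case False
    then have less: "\<bar>n\<bar> < \<bar>m\<bar>" using assms(6) by simp
    have "inv\<^bsub>thompson_V\<^esub> (inv\<^bsub>thompson_V\<^esub> b) \<otimes>\<^bsub>thompson_V\<^esub> a [^]\<^bsub>thompson_V\<^esub> n \<otimes>\<^bsub>thompson_V\<^esub> inv\<^bsub>thompson_V\<^esub> b
        = a [^]\<^bsub>thompson_V\<^esub> m"
      using V.conjugate_swap[OF b _ _ rel] a b by (simp del: thompson_V_mult)
    from V.no_growth_if_conjugate_powers[OF len stretch_inv one a V.inv_closed[OF b] this assms(5) less]
    show ?thesis .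
  qed
  then show False using t by (meson not_le)
qed

section \<open>Generators and relation of Baumslag-Solitar groups\<close>

lemma (in group) word_val_gen_pow:
  assumes "\<And>x. f x \<in> carrier G"
  shows "word_val G f (gen_pow x k) = f x [^] k"
proof -
  have rep: "word_val G f (replicate j (x, e)) = (if e then f x else inv (f x)) [^] j" for j e
  proof (induction j)
    case (Suc j)
    have "(if e then f x else inv (f x)) \<in> carrier G" using assms by simp
    from nat_pow_Suc2[OF this, of j] show ?case using Suc by simp
  qed simp
  show ?thesis
  proof (cases "k \<ge> 0")
    case True
    then have "k = int (nat \<bar>k\<bar>)" by simp
    then have "f x [^] k = f x [^] nat \<bar>k\<bar>" by (metis int_pow_int)
    then show ?thesis using True by (simp only: gen_pow_def rep if_True)
  next
    case False
    then have "k = - int (nat \<bar>k\<bar>)" by simp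
    then have "f x [^] k = inv (f x [^] nat \<bar>k\<bar>)" by (metis assms int_pow_neg_int)
    then show ?thesis using False assms by (simp only: gen_pow_def rep if_False nat_pow_inv)
  qed
qed

lemma pres_class_in_carrier: "pres_class R u \<in> carrier (presented_group R)"
  by (simp add: presented_group_def)

lemma presented_group_one: "\<one>\<^bsub>presented_group R\<^esub> = pres_class R []"
  by (simp add: presented_group_def)

lemma word_val_presented_group:
  "word_val (presented_group R) (\<lambda>x. pres_class R [(x, True)]) u = pres_class R u"
proof (induction u)
  case Nil
  then show ?case by (simp add: presented_group_one)
next
  case (Cons l u)
  interpret P: group "presented_group R" by (rule group_presented_group)
  obtain x e where l: "l = (x, e)" by force
  have "pres_class R [(x, False)] \<otimes>\<^bsub>presented_group R\<^esub> pres_class R [(x, True)] = \<one>\<^bsub>presented_group R\<^esub>"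
    using pres_cancel[of R x False] by (simp add: presented_group_mult presented_group_one pres_class_eq_iff)
  then have inv: "inv\<^bsub>presented_group R\<^esub> pres_class R [(x, True)] = pres_class R [(x, False)]"
    by (intro P.inv_equality pres_class_in_carrier)
  show ?case
    using Cons presented_group_mult[of R "[(x, e)]" u] by (cases e) (simp_all add: l inv)
qed

definition BS_class :: "int \<Rightarrow> int \<Rightarrow> bs_gen gword \<Rightarrow> bs_gen gword set" where
  "BS_class m n = pres_class
     {(gen_pow Gen_b (-1) @ gen_pow Gen_a m @ gen_pow Gen_b 1, gen_pow Gen_a n)}"

abbreviation BS_gen :: "int \<Rightarrow> int \<Rightarrow> bs_gen \<Rightarrow> bs_gen gword set" where
  "BS_gen m n x \<equiv> BS_class m n [(x, True)]"

lemma BS_class_in_carrier [simp]: "BS_class m n u \<in> carrier (BS m n)"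
  by (simp add: BS_class_def BS_def pres_class_in_carrier)

lemma carrier_BS: "carrier (BS m n) = range (BS_class m n)"
  by (simp add: BS_class_def BS_def presented_group_def)

lemma word_val_BS: "word_val (BS m n) (BS_gen m n) u = BS_class m n u"
  unfolding BS_def BS_class_def by (rule word_val_presented_group)

lemma (in group) word_val_BS_relator:
  assumes "\<And>x. f x \<in> carrier G"
  shows "word_val G f (gen_pow Gen_b (-1) @ gen_pow Gen_a m @ gen_pow Gen_b 1)
    = inv f Gen_b \<otimes> f Gen_a [^] (m::int) \<otimes> f Gen_b"
proof -
  have "f Gen_b [^] (- 1 :: int) = inv f Gen_b" using int_pow_neg_int[of "f Gen_b" 1] assms by simp
  then show ?thesis
    using assms by (simp add: word_val_append word_val_gen_pow m_assoc)
qed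

lemma BS_relation:
  "inv\<^bsub>BS m n\<^esub> BS_gen m n Gen_b \<otimes>\<^bsub>BS m n\<^esub> BS_gen m n Gen_a [^]\<^bsub>BS m n\<^esub> m
     \<otimes>\<^bsub>BS m n\<^esub> BS_gen m n Gen_b = BS_gen m n Gen_a [^]\<^bsub>BS m n\<^esub> n"
proof -
  interpret B: group "BS m n" by (rule group_BS)
  have "BS_class m n (gen_pow Gen_b (-1) @ gen_pow Gen_a m @ gen_pow Gen_b 1)
      = BS_class m n (gen_pow Gen_a n)"
    unfolding BS_class_def pres_class_eq_iff by (rule pres_rel) simp
  then show ?thesis
    using B.word_val_BS_relator[of "BS_gen m n" m] B.word_val_gen_pow[of "BS_gen m n" Gen_a n]
    by (simp add: word_val_BS)
qed

lemma (in group) BS_universal: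
  assumes a: "a \<in> carrier G" and b: "b \<in> carrier G"
    and rel: "inv b \<otimes> a [^] m \<otimes> b = a [^] n"
  obtains h where "h \<in> hom (BS m n) G" "h (BS_gen m n Gen_a) = a" "h (BS_gen m n Gen_b) = b"
proof -
  define f where "f x = (case x of Gen_a \<Rightarrow> a | Gen_b \<Rightarrow> b)" for x
  have f: "f x \<in> carrier G" for x using a b by (cases x) (simp_all add: f_def)
  have "word_val G f (gen_pow Gen_b (-1) @ gen_pow Gen_a m @ gen_pow Gen_b 1)
      = word_val G f (gen_pow Gen_a n)"
    using f rel by (simp only: word_val_BS_relator word_val_gen_pow) (simp add: f_def)
  then obtain h where h: "h \<in> hom (BS m n) G" "\<And>u. h (BS_class m n u) = word_val G f u"
    using presented_group_universal[of f
        "{(gen_pow Gen_b (-1) @ gen_pow Gen_a m @ gen_pow Gen_b 1, gen_pow Gen_a n)}"] f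
    unfolding BS_def BS_class_def by auto
  show thesis
    by (rule that[OF h(1)]) (use a b in \<open>simp_all add: h(2) f_def\<close>)
qed

text \<open>The pair \<open>(s, t)\<close> stands for the affine map \<open>z \<mapsto> s z + t\<close> of the real line, and the product for
  composition.\<close>
definition affine_group :: "(real \<times> real) monoid" where
  "affine_group =
    \<lparr>carrier = {(s, t). s \<noteq> 0},
     monoid.mult = (\<lambda>(s, t) (s', t'). (s * s', s * t' + t)),
     one = (1, 0)\<rparr>"

lemma group_affine_group: "group affine_group"
proof (rule groupI)
  fix x assume x: "x \<in> carrier affine_group"
  obtain s t where "x = (s, t)" by force
  with x show "\<exists>y\<in>carrier affine_group. y \<otimes>\<^bsub>affine_group\<^esub> x = \<one>\<^bsub>affine_group\<^esub>"
    by (intro bexI[of _ "(1 / s, - t / s)"]) (auto simp: affine_group_def)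
qed (auto simp: affine_group_def algebra_simps)

lemma affine_translation_pow:
  "(1, t) [^]\<^bsub>affine_group\<^esub> (k::int) = (1, of_int k * t)"
proof -
  interpret A: group affine_group by (rule group_affine_group)
  have nat: "(1, t) [^]\<^bsub>affine_group\<^esub> (k::nat) = (1, of_nat k * t)" for k
    by (induction k) (simp_all add: affine_group_def algebra_simps)
  have inv: "inv\<^bsub>affine_group\<^esub> (1, t) = (1, - t)" for t
    by (rule A.inv_equality) (simp_all add: affine_group_def)
  have in_carrier: "(1, t) \<in> carrier affine_group" by (simp add: affine_group_def)
  show ?thesis
  proof (cases k rule: int_cases2)
    case (nonneg j)
    then show ?thesis by (simp add: int_pow_int nat)
  next
    case (nonpos j)
    then show ?thesis by (simp add: A.int_pow_neg_int[OF in_carrier] nat inv)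
  qed
qed

text \<open>The translation \<open>z \<mapsto> z + 1\<close> and the homothety \<open>z \<mapsto> (m/n) z\<close> satisfy the relation:
  conjugation by the latter scales the translation by \<open>m\<close> to the translation by \<open>n\<close>.\<close>
lemma BS_a_infinite_order:
  assumes "m \<noteq> 0" "n \<noteq> 0" "t > 0"
  shows "BS_gen m n Gen_a [^]\<^bsub>BS m n\<^esub> (t::nat) \<noteq> \<one>\<^bsub>BS m n\<^esub>"
proof
  interpret A: group affine_group by (rule group_affine_group)
  define a :: "real \<times> real" where "a = (1, 1)"
  define b :: "real \<times> real" where "b = (m / n, 0)"
  have a: "a \<in> carrier affine_group" by (simp add: a_def affine_group_def)
  have b: "b \<in> carrier affine_group" using assms by (simp add: b_def affine_group_def)
  have "inv\<^bsub>affine_group\<^esub> b = (n / m, 0)"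
    by (rule A.inv_equality) (use assms in \<open>simp_all add: b_def affine_group_def\<close>)
  then have rel: "inv\<^bsub>affine_group\<^esub> b \<otimes>\<^bsub>affine_group\<^esub> a [^]\<^bsub>affine_group\<^esub> m \<otimes>\<^bsub>affine_group\<^esub> b
      = a [^]\<^bsub>affine_group\<^esub> n"
    using assms by (simp add: a_def affine_translation_pow) (simp add: b_def affine_group_def)
  obtain h where h: "h \<in> hom (BS m n) affine_group" "h (BS_gen m n Gen_a) = a"
      "h (BS_gen m n Gen_b) = b"
    by (rule A.BS_universal[OF a b rel])
  interpret h: group_hom "BS m n" affine_group h
    using h(1) by (simp add: group_hom_def group_hom_axioms_def group_BS group_affine_group)
  assume one: "BS_gen m n Gen_a [^]\<^bsub>BS m n\<^esub> t = \<one>\<^bsub>BS m n\<^esub>"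
  have "a [^]\<^bsub>affine_group\<^esub> int t = h (BS_gen m n Gen_a [^]\<^bsub>BS m n\<^esub> t)"
    by (simp add: h.hom_nat_pow h(2) int_pow_int)
  also have "\<dots> = (1, 0)" by (simp add: one) (simp add: affine_group_def)
  finally show False using assms(3) by (simp add: a_def affine_translation_pow)
qed

lemma BS_not_embeddable:
  assumes "m \<noteq> 0" "n \<noteq> 0" "\<bar>m\<bar> \<noteq> \<bar>n\<bar>"
  shows "\<not> (\<exists>h. h \<in> mon (BS m n) thompson_V)"
proof
  assume "\<exists>h. h \<in> mon (BS m n) thompson_V"
  then obtain h where h: "h \<in> hom (BS m n) thompson_V" "inj_on h (carrier (BS m n))"
    by (auto simp: mon_def)
  interpret h: group_hom "BS m n" thompson_V h
    using h(1) by (simp add: group_hom_def group_hom_axioms_def group_BS group_thompson_V)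
  let ?a = "BS_gen m n Gen_a" and ?b = "BS_gen m n Gen_b"
  have "inv\<^bsub>thompson_V\<^esub> h ?b \<otimes>\<^bsub>thompson_V\<^esub> h ?a [^]\<^bsub>thompson_V\<^esub> m \<otimes>\<^bsub>thompson_V\<^esub> h ?b
      = h (inv\<^bsub>BS m n\<^esub> ?b \<otimes>\<^bsub>BS m n\<^esub> ?a [^]\<^bsub>BS m n\<^esub> m \<otimes>\<^bsub>BS m n\<^esub> ?b)"
    by (simp add: h.hom_int_pow del: thompson_V_mult)
  also have "\<dots> = h ?a [^]\<^bsub>thompson_V\<^esub> n" by (simp add: BS_relation h.hom_int_pow)
  finally obtain t :: nat where t: "t > 0" "h ?a [^]\<^bsub>thompson_V\<^esub> t = \<one>\<^bsub>thompson_V\<^esub>"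
    using conjugate_powers_in_thompson_V[OF h.hom_closed[OF BS_class_in_carrier]
        h.hom_closed[OF BS_class_in_carrier] _ assms] by blast
  then have "h (?a [^]\<^bsub>BS m n\<^esub> t) = h \<one>\<^bsub>BS m n\<^esub>"
    by (simp only: h.hom_nat_pow h.hom_one BS_class_in_carrier)
  then have "?a [^]\<^bsub>BS m n\<^esub> t = \<one>\<^bsub>BS m n\<^esub>"
    using inj_onD[OF h(2)] by simp
  then show False using BS_a_infinite_order[OF assms(1,2) t(1)] by simp
qed

section \<open>Normal forms\<close>

fun syllables_val :: "('g, 'c) monoid_scheme \<Rightarrow> 'g \<Rightarrow> 'g \<Rightarrow> (bool \<times> nat) list \<Rightarrow> 'g" where
  "syllables_val G a b [] = \<one>\<^bsub>G\<^esub>"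
| "syllables_val G a b ((e, i) # L) =
     (if e then b else inv\<^bsub>G\<^esub> b) \<otimes>\<^bsub>G\<^esub> (a [^]\<^bsub>G\<^esub> i \<otimes>\<^bsub>G\<^esub> syllables_val G a b L)"

text \<open>The last conjunct forbids subwords \<open>b b\<inverse>\<close> and \<open>b\<inverse> b\<close>: adjacent factors \<open>b\<close> of opposite signs are
  separated by a nontrivial power of \<open>a\<close> modulo \<open>M\<close>.\<close>
fun reduced_syllables :: "nat \<Rightarrow> (bool \<times> nat) list \<Rightarrow> bool" where
  "reduced_syllables M [] = True"
| "reduced_syllables M ((e, i) # L) \<longleftrightarrow> i < M \<and> reduced_syllables M L \<and> (i = 0 \<and> L \<noteq> [] \<longrightarrow> fst (hd L) = e)"

lemma (in group) syllables_val_closed: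
  "a \<in> carrier G \<Longrightarrow> b \<in> carrier G \<Longrightarrow> syllables_val G a b L \<in> carrier G"
  by (induction L rule: reduced_syllables.induct) auto

lemma (in group_hom) hom_syllables_val:
  "a \<in> carrier G \<Longrightarrow> b \<in> carrier G \<Longrightarrow>
    h (syllables_val G a b L) = syllables_val H (h a) (h b) L"
  by (induction L rule: reduced_syllables.induct) (auto simp: hom_nat_pow G.syllables_val_closed)

text \<open>Powers of \<open>a\<close> with exponent divisible by \<open>M\<close> pass \<open>b\<close> and its inverse at the price of a factor
  \<open>d = \<plusminus>1\<close> in the exponent. So when a letter \<open>b\<^bsup>\<plusminus>1\<^esup>\<close> is put in front of a normal form, the leading power of
  \<open>a\<close> is divided by \<open>M\<close> with remainder: the multiple of \<open>M\<close> moves to the very front, and only the remainder stays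
  behind the new letter, which may then cancel against the next one.\<close>
lemma (in group) reduced_normal_form:
  fixes d :: int
  assumes a: "a \<in> carrier G" and b: "b \<in> carrier G"
    and rel: "inv b \<otimes> a [^] int M \<otimes> b = a [^] (d * int M)" and "M > 0" "\<bar>d\<bar> = 1"
  shows "\<exists>(j::int) L. reduced_syllables M L \<and>
    word_val G (\<lambda>x. case x of Gen_a \<Rightarrow> a | Gen_b \<Rightarrow> b) u = a [^] j \<otimes> syllables_val G a b L"
    (is "\<exists>j L. reduced_syllables M L \<and> word_val G ?f u = _")
proof (induction u)
  case Nil
  have "word_val G ?f [] = a [^] (0::int) \<otimes> syllables_val G a b []" by simp
  then show ?case using reduced_syllables.simps(1) by blast
next
  case (Cons l u)
  then obtain j :: int and L where L: "reduced_syllables M L" and u: "word_val G ?f u = a [^] j \<otimes> syllables_val G a b L"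
    by blast
  note closed = syllables_val_closed[OF a b]
  have dd: "d * d = 1" using \<open>\<bar>d\<bar> = 1\<close> by (metis abs_mult_self_eq mult_1)
  have conj: "inv b \<otimes> a [^] (int M * k) \<otimes> b = a [^] (int M * (d * k))" for k
  proof -
    have "inv b \<otimes> (a [^] int M) [^] k \<otimes> b = (a [^] (d * int M)) [^] k"
      using conjugation_int_pow[of "a [^] int M" b k] a b rel by simp
    then show ?thesis using a by (simp add: int_pow_pow mult_ac)
  qed
  have pass: "(if e then b else inv b) \<otimes> a [^] (int M * k)
      = a [^] (int M * (d * k)) \<otimes> (if e then b else inv b)" for e k
  proof (cases e)
    case True
    have "d * (d * k) = k" using dd by (simp only: mult.assoc[symmetric] mult_1)
    then have "inv b \<otimes> a [^] (int M * (d * k)) \<otimes> b = a [^] (int M * k)"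
      using conj[of "d * k"] by (simp only:)
    from conjugate_commute[OF b _ _ this] show ?thesis using True a by simp
  next
    case False
    from conjugate_swap[OF b _ _ conj[of k]]
    have "inv (inv b) \<otimes> a [^] (int M * (d * k)) \<otimes> inv b = a [^] (int M * k)"
      using a b by simp
    from conjugate_commute[OF _ _ _ this] show ?thesis using False a b by simp
  qed
  obtain x e where l: "l = (x, e)" by force
  show ?case
  proof (cases x)
    case Gen_a
    define c where "c = (if e then a else inv a)"
    define k :: int where "k = (if e then 1 else - 1)"
    have c: "c \<in> carrier G" "c = a [^] k" using a by (simp_all add: c_def k_def int_pow_neg)
    have "word_val G ?f (l # u) = c \<otimes> (a [^] j \<otimes> syllables_val G a b L)"
      by (simp add: l Gen_a u c_def)
    also have "\<dots> = a [^] (k + j) \<otimes> syllables_val G a b L"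
      using a c closed by (simp add: m_assoc[symmetric] int_pow_mult)
    finally have "word_val G ?f (l # u) = a [^] (k + j) \<otimes> syllables_val G a b L" .
    then show ?thesis using L by blast
  next
    case Gen_b
    define i where "i = nat (j mod int M)"
    have i: "i < M" "int i = j mod int M"
      using \<open>M > 0\<close> by (simp_all add: i_def nat_less_iff)
    define k where "k = j div int M"
    have "j = int M * k + int i" using i(2) by (simp add: k_def)
    then have aj: "a [^] j = a [^] (int M * k) \<otimes> a [^] i"
      using int_pow_mult[OF a, of "int M * k" "int i"] by (simp add: int_pow_int)
    define c where "c = (if e then b else inv b)"
    have c: "c \<in> carrier G" using b by (simp add: c_def)
    have "word_val G ?f (l # u) = c \<otimes> (a [^] (int M * k) \<otimes> a [^] i \<otimes> syllables_val G a b L)"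
      by (simp add: l Gen_b u c_def aj)
    also have "\<dots> = c \<otimes> a [^] (int M * k) \<otimes> (a [^] i \<otimes> syllables_val G a b L)"
      using a c closed by (simp add: m_assoc)
    also have "c \<otimes> a [^] (int M * k) = a [^] (int M * (d * k)) \<otimes> c"
      unfolding c_def by (rule pass)
    finally have val: "word_val G ?f (l # u)
        = a [^] (int M * (d * k)) \<otimes> (c \<otimes> (a [^] i \<otimes> syllables_val G a b L))"
      using a c closed by (simp add: m_assoc)
    show ?thesis
    proof (cases "i = 0 \<and> L \<noteq> [] \<and> fst (hd L) \<noteq> e")
      case False
      then have "reduced_syllables M ((e, i) # L)" using L i(1) by auto
      moreover have "word_val G ?f (l # u)
          = a [^] (int M * (d * k)) \<otimes> syllables_val G a b ((e, i) # L)"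
        using val by (simp add: c_def)
      ultimately show ?thesis by blast
    next
      case True
      then obtain i' L' where L': "L = (\<not> e, i') # L'" by (cases L) auto
      have "syllables_val G a b L = inv c \<otimes> (a [^] i' \<otimes> syllables_val G a b L')"
        using b by (simp add: L' c_def)
      moreover have "c \<otimes> (inv c \<otimes> z) = z" if "z \<in> carrier G" for z
        using c that by (simp add: m_assoc[symmetric])
      ultimately have "word_val G ?f (l # u)
          = a [^] (int M * (d * k)) \<otimes> (a [^] int i' \<otimes> syllables_val G a b L')"
        using val True a c closed by (simp add: int_pow_int)
      also have "\<dots> = a [^] (int M * (d * k) + int i') \<otimes> syllables_val G a b L'"
        using int_pow_mult[OF a] a closed by (simp add: m_assoc)
      finally have "word_val G ?f (l # u)
          = a [^] (int M * (d * k) + int i') \<otimes> syllables_val G a b L'" .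
      moreover have "reduced_syllables M L'" using L L' by simp
      ultimately show ?thesis by blast
    qed
  qed
qed

section \<open>A free product acting by ping-pong\<close>

lemma complete_antichain_Nil: "complete_antichain {[] :: bool list}"
  by (subst complete_antichain_iff_unique_prefix) auto

lemma starts_with_snoc: "(\<exists>z. x = (u @ [a]) \<frown> z) \<longleftrightarrow> (\<exists>z. x = u \<frown> z) \<and> x (length u) = a"
proof
  assume "\<exists>z. x = (u @ [a]) \<frown> z"
  then obtain z where "x = (u @ [a]) \<frown> z" by blast
  then have "x = u \<frown> ([a] \<frown> z)" "x (length u) = a" by (simp_all only: conc_conc) simp
  then show "(\<exists>z. x = u \<frown> z) \<and> x (length u) = a" by blast
next
  assume "(\<exists>z. x = u \<frown> z) \<and> x (length u) = a"
  then obtain z where z: "x = u \<frown> z" "z 0 = a" by auto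
  then have "z = [a] \<frown> Omega_Words_Fun.suffix 1 z" using build_first[of z] by simp
  then have "x = (u @ [a]) \<frown> Omega_Words_Fun.suffix 1 z" using z(1) by (metis conc_conc)
  then show "\<exists>z. x = (u @ [a]) \<frown> z" by blast
qed

text \<open>Every complete antichain needed below arises from the one-element antichain of the empty word by
  repeatedly splitting a cone into its two halves.\<close>
lemma complete_antichain_split:
  fixes C :: "bool list set"
  assumes fin: "finite C" and u: "u \<notin> C" and complete: "complete_antichain (insert u C)"
  shows "complete_antichain (insert (u @ [False]) (insert (u @ [True]) C))"
proof -
  define P where "P x v \<longleftrightarrow> (\<exists>z. x = v \<frown> z)" for x :: "bool word" and v
  have ex1: "\<exists>!v. v \<in> insert u C \<and> P x v" for x
    using complete fin by (simp only: P_def complete_antichain_iff_unique_prefix finite_insert)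
  have snoc: "P x (u @ [e]) \<longleftrightarrow> P x u \<and> x (length u) = e" for x e
    by (simp only: P_def starts_with_snoc)
  have "\<exists>!v. v \<in> insert (u @ [False]) (insert (u @ [True]) C) \<and> P x v" for x
  proof (cases "P x u")
    case True
    then have "\<not> P x v" if "v \<in> C" for v using ex1[of x] u that by blast
    with True show ?thesis by (cases "x (length u)") (auto simp: snoc)
  next
    case False
    then obtain v where "v \<in> C" "P x v" "\<And>w. w \<in> C \<Longrightarrow> P x w \<Longrightarrow> w = v"
      using ex1[of x] by blast
    with False show ?thesis by (auto simp: snoc)
  qed
  then show ?thesis
    using fin by (simp only: P_def complete_antichain_iff_unique_prefix finite_insert simp_thms)
qed

lemma thompson_V_element_exists:
  assumes A: "finite A" "inj_on r A" "complete_antichain A" "complete_antichain (r ` A)"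
  obtains f where "f \<in> carrier thompson_V" "\<And>u. u \<in> A \<Longrightarrow> maps_cone f u (r u)"
proof -
  have U: "\<exists>!u. u \<in> A \<and> (\<exists>z. x = u \<frown> z)" for x
    using A(3) complete_antichain_iff_unique_prefix[OF A(1)] by blast
  define f where "f x = (let u = (THE u. u \<in> A \<and> (\<exists>z. x = u \<frown> z)) in r u \<frown> Omega_Words_Fun.suffix (length u) x)" for x
  have f: "maps_cone f u (r u)" if "u \<in> A" for u
    unfolding maps_cone_def
  proof
    fix z
    have "(THE v. v \<in> A \<and> (\<exists>y. u \<frown> z = v \<frown> y)) = u"
      using U[of "u \<frown> z"] that by (intro the1_equality) blast+
    then show "f (u \<frown> z) = r u \<frown> z" by (simp add: f_def)
  qed
  then have "f \<in> carrier thompson_V"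
    unfolding carrier_thompson_V mem_Collect_eq prefix_replacement_iff maps_cone_def
    using A by blast
  with f that show thesis by blast
qed

text \<open>The cones of \<open>comb_tooth 0\<close>, \<dots>, \<open>comb_tooth (M - 1)\<close> are disjoint, and the cone of the word
  \<open>replicate M True\<close> is what they leave over; this provides \<open>M\<close> pieces that can be permuted cyclically and a
  piece that stays fixed, for every \<open>M\<close>.\<close>
definition comb_tooth :: "nat \<Rightarrow> bool list" where
  "comb_tooth i = replicate i True @ [False]"

lemma False_in_comb_tooth: "False \<in> set (comb_tooth i)"
  by (simp add: comb_tooth_def)

lemma length_comb_tooth: "length (comb_tooth i) = Suc i"
  by (simp add: comb_tooth_def)

lemma comb_tooth_ne_replicate: "comb_tooth i \<noteq> replicate M True"
  using False_in_comb_tooth by (metis in_set_replicate)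

lemma comb_tooth_eq_iff: "comb_tooth i = comb_tooth j \<longleftrightarrow> i = j"
  by (metis length_comb_tooth nat.inject)

lemma complete_antichain_comb:
  "complete_antichain (insert (replicate M True) (comb_tooth ` {..<M}))"
proof (induction M)
  case 0
  then show ?case using complete_antichain_Nil by simp
next
  case (Suc M)
  have "replicate M True \<notin> comb_tooth ` {..<M}"
    by (auto simp: comb_tooth_ne_replicate[symmetric])
  from complete_antichain_split[OF _ this Suc]
  show ?case
    by (simp add: comb_tooth_def lessThan_Suc insert_commute replicate_append_same)
qed

lemma ex_rotation:
  assumes "M > 0"
  obtains x where "x \<in> carrier thompson_V" "x ^^ M = id" "x (\<lambda>_. True) = (\<lambda>_. True)"
    "\<And>i. i < M \<Longrightarrow> maps_cone (x ^^ i) [False] (comb_tooth i)"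
proof -
  define A where "A = insert (replicate M True) (comb_tooth ` {..<M})"
  define r where "r u = (if False \<in> set u then comb_tooth (length u mod M) else u)" for u
  have r_tooth: "r (comb_tooth i) = comb_tooth (Suc i mod M)" for i
    by (simp only: r_def False_in_comb_tooth length_comb_tooth if_True)
  have r_all: "r (replicate M True) = replicate M True" by (simp add: r_def)
  have fin: "finite A" by (simp add: A_def)
  have "inj_on r (comb_tooth ` {..<M})"
  proof (rule inj_onI, clarify)
    fix i j assume ij: "i < M" "j < M" "r (comb_tooth i) = r (comb_tooth j)"
    have "Suc k mod M = (if Suc k = M then 0 else Suc k)" if "k < M" for k
      using that by simp
    then have "i = j" using ij by (simp add: r_tooth comb_tooth_eq_iff split: if_splits)
    then show "comb_tooth i = comb_tooth j" by simp
  qed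
  moreover have "r (replicate M True) \<notin> r ` (comb_tooth ` {..<M})"
    by (auto simp: r_all r_tooth comb_tooth_ne_replicate[symmetric])
  ultimately have inj: "inj_on r A" by (auto simp: A_def)
  have "r ` A \<subseteq> A" using assms by (auto simp: A_def r_tooth r_all)
  then have rA: "r ` A = A" using endo_inj_surj[OF fin _ inj] by simp
  have comp: "complete_antichain A" unfolding A_def by (rule complete_antichain_comb)
  have comp': "complete_antichain (r ` A)" using comp rA by simp
  obtain x where x: "x \<in> carrier thompson_V" "\<And>u. u \<in> A \<Longrightarrow> maps_cone x u (r u)"
    using thompson_V_element_exists[OF fin inj comp comp'] by metis
  have step: "maps_cone x (comb_tooth i) (comb_tooth (Suc i mod M))" if "i < M" for i
    using x(2)[of "comb_tooth i"] that by (simp add: A_def r_tooth)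
  have fixed: "maps_cone x (replicate M True) (replicate M True)"
    using x(2)[of "replicate M True"] by (simp add: A_def r_all)
  have rotate: "maps_cone (x ^^ k) (comb_tooth i) (comb_tooth ((i + k) mod M))" if "i < M" for i k
  proof (induction k)
    case 0
    then show ?case using that maps_cone_id[of "comb_tooth i"] by (simp add: id_def)
  next
    case (Suc k)
    have "maps_cone x (comb_tooth ((i + k) mod M)) (comb_tooth ((i + Suc k) mod M))"
      using step[of "(i + k) mod M"] assms by (simp add: mod_Suc_eq)
    from maps_cone_comp[OF Suc this] show ?case by (simp add: comp_def)
  qed
  have fixed_pow: "(x ^^ k) (replicate M True \<frown> z) = replicate M True \<frown> z" for k z
    by (induction k) (simp_all add: maps_coneD[OF fixed])
  have "(x ^^ M) z = z" for z
  proof -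
    have "\<exists>!u. u \<in> A \<and> (\<exists>y. z = u \<frown> y)"
      using comp complete_antichain_iff_unique_prefix[OF fin] by metis
    then obtain u y where u: "u \<in> A" "z = u \<frown> y" by blast
    from u(1) consider "u = replicate M True" | i where "i < M" "u = comb_tooth i"
      by (auto simp: A_def)
    then show ?thesis
    proof cases
      case 1
      then show ?thesis using u(2) fixed_pow by simp
    next
      case 2
      then show ?thesis using maps_coneD[OF rotate[of i M], of y] by (simp add: u(2))
    qed
  qed
  then have pow_M: "x ^^ M = id" by (simp add: fun_eq_iff)
  have all_True: "x (\<lambda>_. True) = (\<lambda>_. True)"
  proof -
    have "replicate M True \<frown> (\<lambda>_. True) = (\<lambda>_. True)" by (auto simp: conc_def)
    then show ?thesis using maps_coneD[OF fixed, of "\<lambda>_. True"] by simp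
  qed
  have tooth_0: "comb_tooth 0 = [False]" by (simp add: comb_tooth_def)
  show thesis
  proof (rule that[OF x(1) pow_M all_True])
    fix i assume "i < M"
    then show "maps_cone (x ^^ i) [False] (comb_tooth i)"
      using rotate[OF assms, of i] by (simp only: tooth_0 add_0 mod_less)
  qed
qed

text \<open>These are the two halves of the first piece \<open>[False] \<frown> _\<close>, the cones of \<open>[False, False]\<close> (for
  \<open>e = True\<close>) and \<open>[False, True]\<close> (for \<open>e = False\<close>); a generator of infinite order
  will send everything outside the second half into the first, and its inverse vice versa.\<close>
definition pong_set :: "bool \<Rightarrow> bool word set" where
  "pong_set e = {z. \<not> z 0 \<and> z 1 = (\<not> e)}"

text \<open>The complement of the cone \<open>01\<close> consists of the cones \<open>00\<close> and \<open>1\<close>, which are mapped onto the two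
  halves of \<open>00\<close>; and the two halves of \<open>01\<close> are mapped onto the cones \<open>01\<close> and \<open>1\<close>, which make up the
  complement of \<open>00\<close>. Here \<open>0\<close> stands for \<open>False\<close> and \<open>1\<close> for \<open>True\<close>.\<close>
lemma ex_ping_pong_element:
  obtains y where "y \<in> carrier thompson_V"
    "\<And>e z. z \<notin> pong_set (\<not> e) \<Longrightarrow> (if e then y else inv\<^bsub>thompson_V\<^esub> y) z \<in> pong_set e"
proof -
  define A where "A = {[False, False], [True], [False, True, False], [False, True, True]}"
  define r where "r u = (if u = [False, False] then [False, False, False]
      else if u = [True] then [False, False, True]
      else if u = [False, True, False] then [False, True] else [True])" for u
  have half: "complete_antichain {[False], [True]}"
    using complete_antichain_split[of "{}" "[]"] complete_antichain_Nil by simp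
  have quarter: "complete_antichain {[False, False], [False, True], [True]}"
    using complete_antichain_split[of "{[True]}" "[False]"] half by simp
  have "complete_antichain A"
    using complete_antichain_split[of "{[False, False], [True]}" "[False, True]"] quarter
    by (simp add: A_def insert_commute)
  moreover have "complete_antichain (r ` A)"
    using complete_antichain_split[of "{[False, True], [True]}" "[False, False]"] quarter
    by (simp add: A_def r_def insert_commute)
  moreover have "finite A" "inj_on r A" by (auto simp: A_def r_def inj_on_def)
  ultimately obtain y where y: "y \<in> carrier thompson_V" "\<And>u. u \<in> A \<Longrightarrow> maps_cone y u (r u)"
    using thompson_V_element_exists by metis
  have "maps_cone y [False, False] [False, False, False]" "maps_cone y [True] [False, False, True]"
    "maps_cone y [False, True, False] [False, True]" "maps_cone y [False, True, True] [True]"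
    using y(2)[of "[False, False]"] y(2)[of "[True]"] y(2)[of "[False, True, False]"]
      y(2)[of "[False, True, True]"] by (simp_all add: A_def r_def)
  then have fwd: "y ([False, False] \<frown> z) = [False, False, False] \<frown> z"
      "y ([True] \<frown> z) = [False, False, True] \<frown> z"
    and bwd: "(inv\<^bsub>thompson_V\<^esub> y) ([False, True] \<frown> z) = [False, True, False] \<frown> z"
      "(inv\<^bsub>thompson_V\<^esub> y) ([True] \<frown> z) = [False, True, True] \<frown> z" for z
    by (simp_all only: maps_cone_inv[OF y(1), symmetric] maps_coneD)
  have one: "z = [True] \<frown> Omega_Words_Fun.suffix 1 z" if "z 0" for z :: "bool word"
    using build_first[of z] that by simp
  have two: "z = [False, e] \<frown> Omega_Words_Fun.suffix 2 z" if "\<not> z 0" "z 1 = e" for z :: "bool word" and e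
  proof -
    have "Omega_Words_Fun.prefix 2 z = [False, e]"
      using that by (simp add: subsequence_def numeral_2_eq_2)
    then show ?thesis using prefix_suffix[of z 2] by simp
  qed
  have "(if e then y else inv\<^bsub>thompson_V\<^esub> y) z \<in> pong_set e" if z: "z \<notin> pong_set (\<not> e)" for e z
  proof (cases "z 0")
    case True
    obtain t where t: "z = [True] \<frown> t" by (rule that[OF one[of z, OF True]])
    have "y z \<in> pong_set True" "(inv\<^bsub>thompson_V\<^esub> y) z \<in> pong_set False"
      by (simp_all only: t fwd bwd) (simp_all add: pong_set_def)
    then show ?thesis by simp
  next
    case False
    then have "z 1 = (\<not> e)" using z by (auto simp: pong_set_def)
    obtain t where t: "z = [False, \<not> e] \<frown> t"
      by (rule that[OF two[of z "\<not> e", OF False \<open>z 1 = (\<not> e)\<close>]])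
    show ?thesis
    proof (cases e)
      case True
      have "y z \<in> pong_set True"
        by (simp only: t True not_True_eq_False fwd) (simp add: pong_set_def)
      then show ?thesis using True by simp
    next
      case False
      have "(inv\<^bsub>thompson_V\<^esub> y) z \<in> pong_set False"
        by (simp only: t False not_False_eq_True bwd) (simp add: pong_set_def)
      then show ?thesis using False by simp
    qed
  qed
  then show thesis using that[OF y(1)] by blast
qed

text \<open>After each syllable the point lies in the set that belongs to the sign of that syllable. A nontrivial
  rotation moves it out of both sets, and without rotation the next sign is the same; so the point
  never lies in the set that the next factor, \<open>y\<close> or its inverse, fails to contract.\<close>
lemma syllables_val_ping_pong:
  assumes "\<And>e. p \<notin> B e" "\<And>i. (x ^^ i) p = p"
    and disj: "B True \<inter> B False = {}"
    and rot: "\<And>e e' i q. 0 < i \<Longrightarrow> i < M \<Longrightarrow> q \<in> B e \<Longrightarrow> (x ^^ i) q \<notin> B e'"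
    and push: "\<And>e q. q \<notin> B (\<not> e) \<Longrightarrow> (if e then y else inv\<^bsub>thompson_V\<^esub> y) q \<in> B e"
    and "reduced_syllables M L" "L \<noteq> []"
  shows "syllables_val thompson_V x y L p \<in> B (fst (hd L))"
  using assms(6,7)
proof (induction L)
  case (Cons l L)
  obtain e i where l: "l = (e, i)" by force
  define q where "q = syllables_val thompson_V x y L p"
  have "(x ^^ i) q \<notin> B (\<not> e)"
  proof (cases "L = []")
    case True
    then show ?thesis using assms(1,2) by (simp add: q_def)
  next
    case False
    then have q: "q \<in> B (fst (hd L))" using Cons by (simp add: l q_def)
    show ?thesis
    proof (cases "i = 0")
      case True
      then have "q \<in> B e" using Cons.prems(1) False q by (simp add: l)
      then show ?thesis using True disj by (cases e) auto
    next
      case False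
      then show ?thesis using rot q Cons.prems(1) by (simp add: l)
    qed
  qed
  from push[OF this] show ?case
    by (simp add: l q_def thompson_V_pow split: if_splits)
qed simp

text \<open>The base point \<open>p\<close> is the constant word \<open>True\<close>: it lies outside both ping-pong sets and in the piece
  fixed by the rotation. A product with at least one syllable therefore moves \<open>p\<close>, and so does every positive
  power of \<open>y\<close>.\<close>
lemma ex_free_product_action:
  assumes "M > 0"
  obtains x y where "x \<in> carrier thompson_V" "y \<in> carrier thompson_V"
    "x [^]\<^bsub>thompson_V\<^esub> M = \<one>\<^bsub>thompson_V\<^esub>"
    "\<And>(j::int) L. reduced_syllables M L \<Longrightarrow>
      x [^]\<^bsub>thompson_V\<^esub> j \<otimes>\<^bsub>thompson_V\<^esub> syllables_val thompson_V x y L = \<one>\<^bsub>thompson_V\<^esub> \<Longrightarrow> L = []"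
    "\<And>k::nat. k > 0 \<Longrightarrow> y [^]\<^bsub>thompson_V\<^esub> k \<noteq> \<one>\<^bsub>thompson_V\<^esub>"
proof -
  define p :: "bool word" where "p = (\<lambda>_. True)"
  obtain x where x: "x \<in> carrier thompson_V" "x ^^ M = id" "x p = p"
      "\<And>i. i < M \<Longrightarrow> maps_cone (x ^^ i) [False] (comb_tooth i)"
    using ex_rotation[OF assms] unfolding p_def by blast
  obtain y where y: "y \<in> carrier thompson_V"
      "\<And>e z. z \<notin> pong_set (\<not> e) \<Longrightarrow> (if e then y else inv\<^bsub>thompson_V\<^esub> y) z \<in> pong_set e"
    using ex_ping_pong_element by blast
  have p: "p \<notin> pong_set e" for e by (simp add: p_def pong_set_def)
  have xp: "(x ^^ i) p = p" for i by (induction i) (simp_all add: x(3))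
  have disj: "pong_set True \<inter> pong_set False = {}" by (auto simp: pong_set_def)
  have rot: "(x ^^ i) q \<notin> pong_set e'" if "0 < i" "i < M" "q \<in> pong_set e" for e e' i q
  proof -
    have "q = [False] \<frown> Omega_Words_Fun.suffix 1 q"
      using that(3) build_first[of q] by (simp add: pong_set_def)
    then have "(x ^^ i) q = comb_tooth i \<frown> Omega_Words_Fun.suffix 1 q"
      using maps_coneD[OF x(4)[OF that(2)]] by metis
    then have "(x ^^ i) q 0" using that(1) by (simp add: comb_tooth_def nth_append)
    then show ?thesis by (simp add: pong_set_def)
  qed
  have "L = []" if "reduced_syllables M L"
      "x [^]\<^bsub>thompson_V\<^esub> j \<otimes>\<^bsub>thompson_V\<^esub> syllables_val thompson_V x y L = \<one>\<^bsub>thompson_V\<^esub>"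
    for j :: int and L
  proof (rule ccontr)
    let ?f = "x [^]\<^bsub>thompson_V\<^esub> j" and ?g = "syllables_val thompson_V x y L"
    assume "L \<noteq> []"
    have "?g p \<in> pong_set (fst (hd L))"
      by (rule syllables_val_ping_pong[where B = pong_set and x = x and M = M])
        (fact p xp disj rot y(2) that(1) \<open>L \<noteq> []\<close>)+
    then have "?g p \<noteq> p" using p by metis
    moreover have "?f (?g p) = p" using fun_cong[OF that(2), of p] by simp
    moreover have "?f p = p" using thompson_V_int_pow_fixpoint[of x p] x(1,3) by blast
    moreover have "inj ?f" using x(1) by (intro bij_is_inj thompson_V_bij) simp
    ultimately show False by (metis injD)
  qed
  moreover have "y [^]\<^bsub>thompson_V\<^esub> k \<noteq> \<one>\<^bsub>thompson_V\<^esub>" if "k > 0" for k :: nat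
  proof -
    have "(y ^^ Suc i) p \<in> pong_set True" for i
    proof (induction i)
      case 0
      then show ?case using y(2)[of p True] p by simp
    next
      case (Suc i)
      then have "(y ^^ Suc i) p \<notin> pong_set (\<not> True)" using disj by auto
      from y(2)[OF this] show ?case by simp
    qed
    from this[of "k - 1"] have "(y ^^ k) p \<noteq> p" using that p by auto
    then show ?thesis by (auto simp: thompson_V_pow)
  qed
  moreover have "x [^]\<^bsub>thompson_V\<^esub> M = \<one>\<^bsub>thompson_V\<^esub>" by (simp add: thompson_V_pow x(2))
  ultimately show thesis using that[OF x(1) y(1)] by blast
qed

section \<open>Acting on the two halves of the Cantor set\<close>

definition halves :: "(bool \<Rightarrow> bool word \<Rightarrow> bool word) \<Rightarrow> bool word \<Rightarrow> bool word" where
  "halves f z = z 0 ## f (z 0) (Omega_Words_Fun.suffix 1 z)"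

definition flip_first :: "bool word \<Rightarrow> bool word" where
  "flip_first z = (\<not> z 0) ## Omega_Words_Fun.suffix 1 z"

lemma suffix_build [simp]: "Omega_Words_Fun.suffix (Suc 0) (a ## z) = z"
  by (simp add: fun_eq_iff)

lemma halves_build [simp]: "halves f (e ## z) = e ## f e z"
  by (simp add: halves_def)

lemma flip_first_build [simp]: "flip_first (e ## z) = (\<not> e) ## z"
  by (simp add: flip_first_def)

lemma word_fun_eqI:
  fixes f g :: "bool word \<Rightarrow> 'a"
  assumes "\<And>e z. f (e ## z) = g (e ## z)"
  shows "f = g"
proof
  fix z show "f z = g z" using assms[of "z 0" "Omega_Words_Fun.suffix (Suc 0) z"] by simp
qed

lemma halves_comp: "halves f \<circ> halves g = halves (\<lambda>e. f e \<circ> g e)"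
  by (rule word_fun_eqI) simp

lemma halves_id: "halves (\<lambda>_. id) = id"
  by (rule word_fun_eqI) simp

lemma halves_eq_iff: "halves f = halves g \<longleftrightarrow> f = g"
proof
  assume eq: "halves f = halves g"
  show "f = g"
  proof (intro ext)
    fix e z n
    show "f e z n = g e z n" using fun_cong[OF eq, of "e ## z"] by simp
  qed
qed simp

lemma halves_closed:
  assumes "\<And>e. f e \<in> carrier thompson_V"
  shows "halves f \<in> carrier thompson_V"
  unfolding thompson_V_iff
proof
  define g where "g e = inv\<^bsub>thompson_V\<^esub> (f e)" for e
  have "g e \<circ> f e = id" "f e \<circ> g e = id" for e
    using V.l_inv[OF assms] V.r_inv[OF assms] by (simp_all add: g_def)
  then have "halves g \<circ> halves f = id" "halves f \<circ> halves g = id"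
    by (simp_all add: halves_comp halves_id)
  then show "bij (halves f)" by (rule o_bij)
  have "\<forall>e. \<exists>N. has_depth (f e) N" using assms by (simp add: thompson_V_iff)
  then obtain N where N: "\<And>e. has_depth (f e) (N e)" by metis
  have "has_depth (halves f) (Suc (max (N True) (N False)))"
    unfolding has_depth_def
  proof (intro allI impI)
    fix w :: "bool list" assume "Suc (max (N True) (N False)) \<le> length w"
    then obtain e w' where w: "w = e # w'" "N e \<le> length w'"
      by (cases w; cases "hd w") auto
    then obtain v where "maps_cone (f e) w' v" using has_depthE[OF N] by blast
    then have "maps_cone (halves f) w (e # v)" by (simp add: w(1) maps_cone_def)
    then show "\<exists>v. maps_cone (halves f) w v" by blast
  qed
  then show "\<exists>N. has_depth (halves f) N" by blast
qed

lemma flip_first_involution: "flip_first \<circ> flip_first = id"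
  by (rule word_fun_eqI) simp

lemma flip_first_closed: "flip_first \<in> carrier thompson_V"
  unfolding thompson_V_iff
proof
  show "bij flip_first" using flip_first_involution flip_first_involution by (rule o_bij)
  have "has_depth flip_first 1"
    unfolding has_depth_def
  proof (intro allI impI)
    fix w :: "bool list" assume "1 \<le> length w"
    then obtain e w' where "w = e # w'" by (cases w) auto
    then have "maps_cone flip_first w ((\<not> e) # w')" by (simp add: maps_cone_def)
    then show "\<exists>v. maps_cone flip_first w v" by blast
  qed
  then show "\<exists>N. has_depth flip_first N" by blast
qed

lemma flip_first_conjugates_halves: "flip_first \<circ> halves f \<circ> flip_first = halves (\<lambda>e. f (\<not> e))"
  by (rule word_fun_eqI) simp

lemma inv_flip_first: "inv\<^bsub>thompson_V\<^esub> flip_first = flip_first"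
  by (rule V.inv_equality) (simp_all add: flip_first_involution flip_first_closed)

text \<open>This is the inclusion of \<open>V \<times> V\<close> in \<open>V\<close> that lets the two factors act on the two halves.\<close>
lemma joint_embedding:
  assumes G: "group G" and h1: "h1 \<in> hom G thompson_V" and h2: "h2 \<in> hom G thompson_V"
    and inj: "\<And>g. g \<in> carrier G \<Longrightarrow> h1 g = \<one>\<^bsub>thompson_V\<^esub> \<Longrightarrow> h2 g = \<one>\<^bsub>thompson_V\<^esub> \<Longrightarrow> g = \<one>\<^bsub>G\<^esub>"
  shows "\<exists>h. h \<in> mon G thompson_V"
proof -
  define h where "h g = halves (\<lambda>e. if e then h1 g else h2 g)" for g
  have "h \<in> hom G thompson_V"
  proof (rule homI)
    fix g assume "g \<in> carrier G"
    then show "h g \<in> carrier thompson_V"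
      using hom_in_carrier[OF h1] hom_in_carrier[OF h2] by (simp add: h_def halves_closed)
  next
    fix g g' assume "g \<in> carrier G" "g' \<in> carrier G"
    then have "h1 (g \<otimes>\<^bsub>G\<^esub> g') = h1 g \<circ> h1 g'" "h2 (g \<otimes>\<^bsub>G\<^esub> g') = h2 g \<circ> h2 g'"
      using hom_mult[OF h1] hom_mult[OF h2] by simp_all
    then show "h (g \<otimes>\<^bsub>G\<^esub> g') = h g \<otimes>\<^bsub>thompson_V\<^esub> h g'"
      by (auto simp: h_def halves_comp halves_eq_iff)
  qed
  then interpret h: group_hom G thompson_V h
    using G by (simp add: group_hom_def group_hom_axioms_def group_thompson_V)
  have "g = \<one>\<^bsub>G\<^esub>" if "g \<in> carrier G" "h g = \<one>\<^bsub>thompson_V\<^esub>" for g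
  proof -
    have "halves (\<lambda>e. if e then h1 g else h2 g) = halves (\<lambda>_. id)"
      using that(2) by (simp add: h_def halves_id)
    then have "(if e then h1 g else h2 g) = id" for e by (metis halves_eq_iff)
    from this[of True] this[of False] show ?thesis using inj[OF that(1)] by simp
  qed
  then have "inj_on h (carrier G)" by (simp add: h.inj_on_one_iff)
  then show ?thesis unfolding mon_def using h.homh by blast
qed

text \<open>Let \<open>a\<close> act as \<open>y\<close> on one half and as the inverse of \<open>y\<close> on the other. Exchanging the halves
  inverts \<open>a\<close>, and the identity commutes with it.\<close>
lemma ex_commuting_or_inverting_pair:
  fixes d :: int
  assumes y: "y \<in> carrier thompson_V" "\<And>k::nat. k > 0 \<Longrightarrow> y [^]\<^bsub>thompson_V\<^esub> k \<noteq> \<one>\<^bsub>thompson_V\<^esub>"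
    and d: "\<bar>d\<bar> = 1"
  obtains a b where "a \<in> carrier thompson_V" "b \<in> carrier thompson_V"
    "inv\<^bsub>thompson_V\<^esub> b \<otimes>\<^bsub>thompson_V\<^esub> a \<otimes>\<^bsub>thompson_V\<^esub> b = a [^]\<^bsub>thompson_V\<^esub> d"
    "\<And>j::int. a [^]\<^bsub>thompson_V\<^esub> j = \<one>\<^bsub>thompson_V\<^esub> \<Longrightarrow> j = 0"
proof -
  let ?y' = "inv\<^bsub>thompson_V\<^esub> y"
  define a where "a = halves (\<lambda>e. if e then y else ?y')"
  have a: "a \<in> carrier thompson_V" unfolding a_def using y(1) by (intro halves_closed) simp
  have yy: "y \<circ> ?y' = id" "?y' \<circ> y = id" using V.r_inv[OF y(1)] V.l_inv[OF y(1)] by simp_all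
  have "flip_first \<circ> a \<circ> flip_first = halves (\<lambda>e. if e then ?y' else y)"
    unfolding a_def flip_first_conjugates_halves by (rule arg_cong[where f = halves]) auto
  moreover have "inv\<^bsub>thompson_V\<^esub> a = halves (\<lambda>e. if e then ?y' else y)"
  proof (rule V.inv_equality)
    have "(\<lambda>e. (if e then ?y' else y) \<circ> (if e then y else ?y')) = (\<lambda>_. id)"
      by (intro ext) (simp add: yy del: comp_apply)
    then show "halves (\<lambda>e. if e then ?y' else y) \<otimes>\<^bsub>thompson_V\<^esub> a = \<one>\<^bsub>thompson_V\<^esub>"
      by (simp only: thompson_V_mult thompson_V_one a_def halves_comp halves_id)
  qed (use a y(1) in \<open>auto intro: halves_closed\<close>)
  ultimately have flip: "inv\<^bsub>thompson_V\<^esub> flip_first \<otimes>\<^bsub>thompson_V\<^esub> a \<otimes>\<^bsub>thompson_V\<^esub> flip_first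
      = inv\<^bsub>thompson_V\<^esub> a"
    by (simp add: inv_flip_first)
  define b where "b = (if d = 1 then \<one>\<^bsub>thompson_V\<^esub> else flip_first)"
  have b: "b \<in> carrier thompson_V" unfolding b_def using flip_first_closed V.one_closed by simp
  have rel: "inv\<^bsub>thompson_V\<^esub> b \<otimes>\<^bsub>thompson_V\<^esub> a \<otimes>\<^bsub>thompson_V\<^esub> b = a [^]\<^bsub>thompson_V\<^esub> d"
  proof (cases "d = 1")
    case True
    then show ?thesis using a by (simp add: b_def del: thompson_V_mult thompson_V_one)
  next
    case False
    then have "d = - int 1" using d by simp
    then have "a [^]\<^bsub>thompson_V\<^esub> d = inv\<^bsub>thompson_V\<^esub> a"
      using V.int_pow_neg_int[OF a, of 1] a by simp
    with flip False show ?thesis by (simp add: b_def)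
  qed
  have inf: "a [^]\<^bsub>thompson_V\<^esub> k \<noteq> \<one>\<^bsub>thompson_V\<^esub>" if "k > 0" for k :: nat
  proof
    have "(a ^^ k) (True ## z) = True ## (y ^^ k) z" for z
      by (induction k) (simp_all add: a_def)
    moreover assume "a [^]\<^bsub>thompson_V\<^esub> k = \<one>\<^bsub>thompson_V\<^esub>"
    ultimately have "(y ^^ k) z = z" for z by (simp add: thompson_V_pow)
    then have "y [^]\<^bsub>thompson_V\<^esub> k = \<one>\<^bsub>thompson_V\<^esub>" by (simp add: thompson_V_pow fun_eq_iff)
    then show False using y(2)[OF that] by simp
  qed
  have "j = 0" if "a [^]\<^bsub>thompson_V\<^esub> j = \<one>\<^bsub>thompson_V\<^esub>" for j :: int
  proof (cases j rule: int_cases2)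
    case (nonneg k)
    then have "a [^]\<^bsub>thompson_V\<^esub> k = \<one>\<^bsub>thompson_V\<^esub>" using that by (simp only: int_pow_int)
    then show ?thesis using inf[of k] nonneg by (cases "k = 0") auto
  next
    case (nonpos k)
    then have "inv\<^bsub>thompson_V\<^esub> (a [^]\<^bsub>thompson_V\<^esub> k) = \<one>\<^bsub>thompson_V\<^esub>"
      using that V.int_pow_neg_int[OF a, of k] by simp
    then have "a [^]\<^bsub>thompson_V\<^esub> k = \<one>\<^bsub>thompson_V\<^esub>"
      using V.inv_eq_1_iff[of "a [^]\<^bsub>thompson_V\<^esub> k"] a by simp
    then show ?thesis using inf[of k] nonpos by (cases "k = 0") auto
  qed
  then show thesis using that[OF a b rel] by blast
qed

text \<open>An element killed by the ping-pong homomorphism \<open>h1\<close> has an empty list of syllables in its normal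
  form, hence is a power of \<open>a\<close>; and \<open>h2\<close> is injective on the powers of \<open>a\<close>.\<close>
lemma BS_embeddable:
  assumes "m \<noteq> 0" "\<bar>m\<bar> = \<bar>n\<bar>"
  shows "\<exists>h. h \<in> mon (BS m n) thompson_V"
proof -
  interpret B: group "BS m n" by (rule group_BS)
  define M where "M = nat \<bar>m\<bar>"
  define s where "s = sgn m"
  define d where "d = sgn m * sgn n"
  have M: "M > 0" "int M = m * s" "m = int M * s" using assms(1)
    by (simp_all add: M_def s_def sgn_if)
  have d: "\<bar>d\<bar> = 1" "n = d * m"
    using assms by (auto simp: d_def abs_mult sgn_if abs_if split: if_splits)
  obtain x y where x: "x \<in> carrier thompson_V" and y: "y \<in> carrier thompson_V"
    and xM: "x [^]\<^bsub>thompson_V\<^esub> M = \<one>\<^bsub>thompson_V\<^esub>"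
    and free: "\<And>(j::int) L. reduced_syllables M L \<Longrightarrow>
      x [^]\<^bsub>thompson_V\<^esub> j \<otimes>\<^bsub>thompson_V\<^esub> syllables_val thompson_V x y L = \<one>\<^bsub>thompson_V\<^esub> \<Longrightarrow> L = []"
    and y_inf: "\<And>k::nat. k > 0 \<Longrightarrow> y [^]\<^bsub>thompson_V\<^esub> k \<noteq> \<one>\<^bsub>thompson_V\<^esub>"
    using ex_free_product_action[OF M(1)] by metis
  obtain a b where a: "a \<in> carrier thompson_V" and b: "b \<in> carrier thompson_V"
    and ab: "inv\<^bsub>thompson_V\<^esub> b \<otimes>\<^bsub>thompson_V\<^esub> a \<otimes>\<^bsub>thompson_V\<^esub> b = a [^]\<^bsub>thompson_V\<^esub> d"
    and a_inf: "\<And>j::int. a [^]\<^bsub>thompson_V\<^esub> j = \<one>\<^bsub>thompson_V\<^esub> \<Longrightarrow> j = 0"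
    using ex_commuting_or_inverting_pair[OF y y_inf d(1)] by metis
  have "x [^]\<^bsub>thompson_V\<^esub> (int M * k) = \<one>\<^bsub>thompson_V\<^esub>" for k
    using V.int_pow_pow[OF x, of "int M" k] xM by (simp only: int_pow_int V.int_pow_one)
  from this[of s] this[of "s * d"]
  have "x [^]\<^bsub>thompson_V\<^esub> m = \<one>\<^bsub>thompson_V\<^esub>" "x [^]\<^bsub>thompson_V\<^esub> n = \<one>\<^bsub>thompson_V\<^esub>"
    unfolding d(2) M(3) by (simp_all only: mult_ac)
  then have rel1: "inv\<^bsub>thompson_V\<^esub> y \<otimes>\<^bsub>thompson_V\<^esub> x [^]\<^bsub>thompson_V\<^esub> m \<otimes>\<^bsub>thompson_V\<^esub> y
      = x [^]\<^bsub>thompson_V\<^esub> n"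
    using y by (simp del: thompson_V_mult thompson_V_one)
  have rel2: "inv\<^bsub>thompson_V\<^esub> b \<otimes>\<^bsub>thompson_V\<^esub> a [^]\<^bsub>thompson_V\<^esub> m \<otimes>\<^bsub>thompson_V\<^esub> b
      = a [^]\<^bsub>thompson_V\<^esub> n"
    using V.conjugation_int_pow[OF a b, of m] V.int_pow_pow[OF a, of d m] by (simp only: ab d(2))
  obtain h1 where h1: "h1 \<in> hom (BS m n) thompson_V" "h1 (BS_gen m n Gen_a) = x" "h1 (BS_gen m n Gen_b) = y"
    by (rule V.BS_universal[OF x y rel1])
  obtain h2 where h2: "h2 \<in> hom (BS m n) thompson_V" "h2 (BS_gen m n Gen_a) = a" "h2 (BS_gen m n Gen_b) = b"
    by (rule V.BS_universal[OF a b rel2])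
  interpret h1: group_hom "BS m n" thompson_V h1
    using h1(1) by (simp add: group_hom_def group_hom_axioms_def group_BS group_thompson_V)
  interpret h2: group_hom "BS m n" thompson_V h2
    using h2(1) by (simp add: group_hom_def group_hom_axioms_def group_BS group_thompson_V)
  let ?A = "BS_gen m n Gen_a" and ?B = "BS_gen m n Gen_b"
  have rel: "inv\<^bsub>BS m n\<^esub> ?B \<otimes>\<^bsub>BS m n\<^esub> ?A [^]\<^bsub>BS m n\<^esub> int M \<otimes>\<^bsub>BS m n\<^esub> ?B
      = ?A [^]\<^bsub>BS m n\<^esub> (d * int M)"
  proof -
    have "inv\<^bsub>BS m n\<^esub> ?B \<otimes>\<^bsub>BS m n\<^esub> (?A [^]\<^bsub>BS m n\<^esub> m) [^]\<^bsub>BS m n\<^esub> s \<otimes>\<^bsub>BS m n\<^esub> ?B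
        = (?A [^]\<^bsub>BS m n\<^esub> n) [^]\<^bsub>BS m n\<^esub> s"
      using B.conjugation_int_pow[of "?A [^]\<^bsub>BS m n\<^esub> m" ?B s] by (simp add: BS_relation)
    then have "inv\<^bsub>BS m n\<^esub> ?B \<otimes>\<^bsub>BS m n\<^esub> ?A [^]\<^bsub>BS m n\<^esub> (m * s) \<otimes>\<^bsub>BS m n\<^esub> ?B
        = ?A [^]\<^bsub>BS m n\<^esub> (n * s)"
      by (simp only: B.int_pow_pow[OF BS_class_in_carrier])
    moreover have "n * s = d * (m * s)" by (simp only: d(2) mult.assoc)
    ultimately show ?thesis by (simp only: M(2))
  qed
  show ?thesis
  proof (rule joint_embedding[OF group_BS h1(1) h2(1)])
    fix g assume "g \<in> carrier (BS m n)"
      and g1: "h1 g = \<one>\<^bsub>thompson_V\<^esub>" and g2: "h2 g = \<one>\<^bsub>thompson_V\<^esub>"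
    then obtain u where u: "g = BS_class m n u" by (auto simp: carrier_BS)
    have "(\<lambda>c. BS_gen m n c) = (\<lambda>c. case c of Gen_a \<Rightarrow> ?A | Gen_b \<Rightarrow> ?B)"
      by (simp add: fun_eq_iff split: bs_gen.split)
    then have "g = word_val (BS m n) (\<lambda>c. case c of Gen_a \<Rightarrow> ?A | Gen_b \<Rightarrow> ?B) u"
      using word_val_BS[of m n u] u by simp
    then obtain j :: int and L where L: "reduced_syllables M L"
        "g = ?A [^]\<^bsub>BS m n\<^esub> j \<otimes>\<^bsub>BS m n\<^esub> syllables_val (BS m n) ?A ?B L"
      using B.reduced_normal_form[OF BS_class_in_carrier BS_class_in_carrier rel M(1) d(1), of u]
      by metis
    have "h1 g = x [^]\<^bsub>thompson_V\<^esub> j \<otimes>\<^bsub>thompson_V\<^esub> syllables_val thompson_V x y L"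
      using L(2) B.syllables_val_closed[of ?A ?B L]
      by (simp add: h1.hom_int_pow h1.hom_syllables_val h1(2,3) del: thompson_V_mult)
    then have "L = []" using free[OF L(1), of j] g1 by metis
    then have g: "g = ?A [^]\<^bsub>BS m n\<^esub> j" using L(2) by simp
    then have "a [^]\<^bsub>thompson_V\<^esub> j = \<one>\<^bsub>thompson_V\<^esub>"
      using g2 by (simp add: h2.hom_int_pow h2(2))
    then have "j = 0" by (rule a_inf)
    then show "g = \<one>\<^bsub>BS m n\<^esub>" using g by simp
  qed
qed

theorem theorem6:
  fixes m n :: int
  assumes "m \<noteq> 0" and "n \<noteq> 0"
  shows "(\<bar>m\<bar> \<noteq> \<bar>n\<bar> \<longrightarrow> \<not> (\<exists>h. h \<in> mon (BS m n) thompson_V)) \<and>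
         (\<bar>m\<bar> = \<bar>n\<bar> \<longrightarrow> (\<exists>h. h \<in> mon (BS m n) thompson_V))"
  using BS_not_embeddable[OF assms] BS_embeddable[OF assms(1)] by blast

end
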